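(* For each $m=2^d$ with $d=0,1,2,\ldots$ there are exactly $2^{2m-1}$ binary $(m,m)$-nested perfect necklaces, and they are exactly the $(m,m)$-affine necklaces.
   Context: Alphabet $\mathbb{F}_2=\{0,1\}$ (the field with two elements). A necklace is the equivalence class of a word under rotations. For positive integers $k,m$, a necklace is $(k,m)$-perfect if each word of length $k$ occurs exactly $m$ times in it, at positions which are pairwise different modulo $m$, for any convention on the starting point; its length is $m2^k$. A word $w$ (a single word with a fixed initial position) is a $(k,m)$-nested perfect necklace if for each $\ell=1,\ldots,k$, each block of $w$ of length $m2^\ell$ starting at a position congruent to $1$ modulo $m2^\ell$ is an $(\ell,m)$-perfect necklace. Words of length $n$ over $\mathbb{F}_2$ are identified with column vectors in $\mathbb{F}_2^n$; $\oplus$ denotes componentwise sum. Define $m\times m$ matrices ($m=2^d$) by $M_0=(1)$ and $M_{d+1}=\begin{pmatrix} M_d & M_d\\ 0 & M_d\end{pmatrix}$. Let $\sigma$ map a word $a_1\cdots a_n$ to $a_na_1\cdots a_{n-1}$ (also applied to column vectors). For integers $n_1,\ldots,n_m$ with $n_m=0$ and $n_{i+1}\le n_i\le n_{i+1}+1$ for $1\le i<m$, and $C_1,\ldots,C_m$ the columns of $M_d$, let $M_d^{n_1,\ldots,n_m}=(\sigma^{n_1}(C_1),\ldots,\sigma^{n_m}(C_m))$. Let $w_1,\ldots,w_{2^m}$ be all words of length $m$ over $\mathbb{F}_2$ in lexicographic order, let $z$ be a fixed word of length $m$, $w'_i=w_i\oplus z$, and let $M$ be one of the matrices $M_d^{n_1,\ldots,n_m}$.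 For $1\le k\le m$, the concatenation $(Mw'_1)(Mw'_2)\cdots(Mw'_{2^k})$ is called a $(k,m)$-affine necklace. *)

theory Defs
  imports "Jordan_Normal_Form.Matrix" "HOL-Library.Z2"
begin

type_synonym word = "bit list"

definition necklace :: "word \<Rightarrow> word set" where
  "necklace w = {rotate r w | r. True}"

text \<open>Positions are counted from \<open>0\<close>, and occurrences are circular.\<close>

definition occurrences :: "word \<Rightarrow> word \<Rightarrow> nat set" where
  "occurrences u v =
     {i. i < length v \<and> (\<forall>j < length u. v ! ((i + j) mod length v) = u ! j)}"

text \<open>The quantifier over \<open>v \<in> N\<close> says ``for any convention on the starting point''.\<close>

definition perfect_necklace :: "nat \<Rightarrow> nat \<Rightarrow> word set \<Rightarrow> bool" where
  "perfect_necklace k m N \<longleftrightarrow> 0 < k \<and> 0 < m \<and>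
     (\<forall>v \<in> N. \<forall>u. length u = k \<longrightarrow>
        card (occurrences u v) = m \<and>
        (\<forall>i \<in> occurrences u v. \<forall>j \<in> occurrences u v. i \<noteq> j \<longrightarrow> i mod m \<noteq> j mod m))"

text \<open>
  A position congruent to \<open>1\<close> when counting from \<open>1\<close> is congruent to \<open>0\<close> when counting from
  \<open>0\<close>.  A nested perfect necklace is itself a single block of the largest size, so its length
  is \<open>m * 2 ^ k\<close>; without this the blocks would not need to cover the word.
\<close>

definition nested_perfect_necklace :: "nat \<Rightarrow> nat \<Rightarrow> word \<Rightarrow> bool" where
  "nested_perfect_necklace k m w \<longleftrightarrow> 0 < k \<and> 0 < m \<and> length w = m * 2 ^ k \<and>
     (\<forall>l \<in> {1..k}. \<forall>p. p mod (m * 2 ^ l) = 0 \<and> p + m * 2 ^ l \<le> length w \<longrightarrow>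
        perfect_necklace l m (necklace (take (m * 2 ^ l) (drop p w))))"

fun Mmat :: "nat \<Rightarrow> bit mat" where
  "Mmat 0 = mat 1 1 (\<lambda>_. 1)"
| "Mmat (Suc d) = four_block_mat (Mmat d) (Mmat d) (0\<^sub>m (2 ^ d) (2 ^ d)) (Mmat d)"

lemma Mmat_carrier [simp]: "Mmat d \<in> carrier_mat (2 ^ d) (2 ^ d)"
proof (induction d)
  case (Suc d)
  have "four_block_mat (Mmat d) (Mmat d) (0\<^sub>m (2 ^ d) (2 ^ d)) (Mmat d)
      \<in> carrier_mat (2 ^ d + 2 ^ d) (2 ^ d + 2 ^ d)"
    using Suc by (intro four_block_carrier_mat)
  then show ?case by (simp add: mult_2)
qed simp

definition shift :: "word \<Rightarrow> word" where
  "shift w = (if w = [] then [] else last w # butlast w)"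

text \<open>
  The list \<open>ns\<close> is \<open>n\<^sub>1, \<dots>, n\<^sub>m\<close>, that is, \<open>n\<^sub>i\<close> is \<open>ns ! (i - 1)\<close>.
  Natural numbers suffice since \<open>n\<^sub>1 \<ge> \<dots> \<ge> n\<^sub>m = 0\<close>.
\<close>

definition valid_shifts :: "nat \<Rightarrow> nat list \<Rightarrow> bool" where
  "valid_shifts m ns \<longleftrightarrow> length ns = m \<and> ns ! (m - 1) = 0 \<and>
     (\<forall>i. Suc i < m \<longrightarrow> ns ! Suc i \<le> ns ! i \<and> ns ! i \<le> ns ! Suc i + 1)"

definition shifted_Mmat :: "nat \<Rightarrow> nat list \<Rightarrow> bit mat" where
  "shifted_Mmat d ns = mat_of_cols (2 ^ d)
     (map (\<lambda>j. vec_of_list ((shift ^^ (ns ! j)) (list_of_vec (col (Mmat d) j)))) [0..<2 ^ d])"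

definition lex_words :: "nat \<Rightarrow> word list" where
  "lex_words m = (THE ws. set ws = {w. length w = m} \<and>
     sorted_wrt (\<lambda>u v. (u, v) \<in> lexord {(0, 1)}) ws)"

definition affine_necklace :: "nat \<Rightarrow> nat \<Rightarrow> word \<Rightarrow> bool" where
  "affine_necklace k m w \<longleftrightarrow> 1 \<le> k \<and> k \<le> m \<and>
     (\<exists>d ns z. m = 2 ^ d \<and> valid_shifts m ns \<and> length z = m \<and>
        w = concat (map (\<lambda>u. list_of_vec (shifted_Mmat d ns *\<^sub>v (vec_of_list u + vec_of_list z)))
              (take (2 ^ k) (lex_words m))))"

text \<open>The definite description in \<open>lex_words\<close> is well-defined and has a computable form.\<close>

fun enum_words :: "nat \<Rightarrow> word list" where
  "enum_words 0 = [[]]"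
| "enum_words (Suc n) = map ((#) 0) (enum_words n) @ map ((#) 1) (enum_words n)"

lemma set_enum_words: "set (enum_words m) = {w. length w = m}"
proof (induction m)
  case (Suc m)
  have "w \<in> set (enum_words (Suc m)) \<longleftrightarrow> length w = Suc m" for w
    using Suc by (cases w; cases "hd w") auto
  then show ?case by blast
qed simp

lemma sorted_enum_words:
  "sorted_wrt (\<lambda>u v. (u, v) \<in> lexord {(0, 1)}) (enum_words m)"
  by (induction m) (auto simp: sorted_wrt_append sorted_wrt_map)

lemma lex_words_eq_enum_words: "lex_words m = enum_words m"
proof -
  let ?R = "\<lambda>u v :: word. (u, v) \<in> lexord {(0, 1)}"
  have asym: "\<not> ?R v u" if "?R u v" for u v
    using that lexord_asymmetric[of "{(0 :: bit, 1)}" u v] by (auto simp: asym_on_def)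
  have uniq: "ws = vs" if "sorted_wrt ?R ws" "sorted_wrt ?R vs" "set ws = set vs" for ws vs
    using that
  proof (induction ws arbitrary: vs)
    case (Cons x xs)
    then obtain y ys where vs: "vs = y # ys" by (cases vs) auto
    have "x = y"
      using Cons.prems asym unfolding vs by (metis insert_iff list.simps(15) sorted_wrt.simps(2))
    moreover have "x \<notin> set xs" "y \<notin> set ys"
      using Cons.prems asym unfolding vs by (meson sorted_wrt.simps(2))+
    ultimately have "set xs = set ys"
      using Cons.prems(3) unfolding vs by auto
    then show ?case
      using Cons.IH[of ys] Cons.prems \<open>x = y\<close> unfolding vs by simp
  qed simp
  show ?thesis
    unfolding lex_words_def
    by (rule the_equality) (use set_enum_words sorted_enum_words uniq in auto)
qed

end

theory Submission
  imports Defs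
begin

text \<open>
  Read as a polynomial in \<open>F\<^sub>2[x] / (x\<^sup>m + 1) = F\<^sub>2[x] / (x + 1)\<^sup>m\<close>, column \<open>j\<close> of the shifted matrix,
  counted from \<open>0\<close>, is \<open>x\<^bsup>n\<^esup> (1 + x)\<^bsup>j\<^esup>\<close>. So the last \<open>k\<close> columns span the \<open>m\<close>-periodic
  sequences killed by the \<open>k\<close>-th power of the difference operator, and such a sequence vanishes as
  soon as it has \<open>k\<close> cyclically consecutive zeros. A word across a block boundary consists of a
  suffix of one block and a prefix of the next; two blocks and their two successors differ first in
  the same binary digit, and the condition on the shifts makes the column of that digit visible in
  the suffix or in the prefix, or else gives one of the two differences \<open>k\<close> consecutive zeros.
  Hence affine necklaces are nested perfect.

  Conversely, let \<open>x y\<close> be nested perfect with \<open>x\<close> and \<open>y\<close> affine by induction. The word \<open>x\<close>, closed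
  up, is a Hamiltonian cycle in the graph whose vertices are the pairs of a word of length \<open>k\<close> and a
  residue modulo \<open>m\<close>, every vertex having two successors. The complementary edges form the cycle of
  the affine necklace \<open>z\<close> obtained by adding to \<open>x\<close> an admissible next column. Perfectness of \<open>x y\<close>
  forces \<open>y\<close> to use these edges too, up to an exchange at two vertices, which would disconnect the
  cycle. So \<open>y\<close> is a rotation of \<open>z\<close> by whole blocks, and as \<open>y\<close> is affine itself, the rotation is
  trivial or by half the length; these two cases are the two admissible shifts of the next column.
\<close>

section \<open>The Pascal matrix modulo 2\<close>

text \<open>These two rules turn ring operations on \<^typ>\<open>bit\<close> into bitwise ones, out of reach of the ring
  simplification rules.\<close>

declare add_bit_eq_xor [simp del] mult_bit_eq_and [simp del]

lemma bit_add_self [simp]: "x + x = (0 :: bit)"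
  by (cases x) simp_all

lemma bit_add_eq_0_iff [simp]: "x + y = 0 \<longleftrightarrow> x = (y :: bit)"
  by (cases x; cases y) simp_all

lemma bit_add_eq_1_iff: "x + y = 1 \<longleftrightarrow> x \<noteq> (y :: bit)"
  by (cases x; cases y) simp_all

lemma Mmat_dims [simp]: "dim_row (Mmat d) = 2 ^ d" "dim_col (Mmat d) = 2 ^ d"
  using Mmat_carrier[of d] by (simp_all only: carrier_matD)

lemma Mmat_Suc_index:
  assumes "i < 2 ^ Suc d" "j < 2 ^ Suc d"
  shows "Mmat (Suc d) $$ (i, j) =
    (if i < 2 ^ d then Mmat d $$ (i, if j < 2 ^ d then j else j - 2 ^ d)
     else if j < 2 ^ d then 0 else Mmat d $$ (i - 2 ^ d, j - 2 ^ d))"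
  using assms by (auto simp: index_mat_four_block)

lemma Mmat_first_row: "j < 2 ^ d \<Longrightarrow> Mmat d $$ (0, j) = 1"
proof (induction d arbitrary: j)
  case (Suc d)
  then show ?case by (subst Mmat_Suc_index) auto
qed simp

lemma Mmat_last_col: "i < 2 ^ d \<Longrightarrow> Mmat d $$ (i, 2 ^ d - 1) = 1"
proof (induction d arbitrary: i)
  case (Suc d)
  have "\<not> 2 ^ Suc d - 1 < (2::nat) ^ d" "2 ^ Suc d - 1 - 2 ^ d = (2::nat) ^ d - 1"
    by (simp_all add: not_less Suc_le_eq flip: Suc_le_eq) 
  with Suc show ?case by (subst Mmat_Suc_index) auto
qed simp

lemma Mmat_below_diag: "i < 2 ^ d \<Longrightarrow> j < i \<Longrightarrow> Mmat d $$ (i, j) = 0"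
proof (induction d arbitrary: i j)
  case (Suc d)
  then show ?case by (subst Mmat_Suc_index) auto
qed simp

lemma Mmat_diag: "i < 2 ^ d \<Longrightarrow> Mmat d $$ (i, i) = 1"
proof (induction d arbitrary: i)
  case (Suc d)
  then show ?case by (subst Mmat_Suc_index) auto
qed simp

lemma Mmat_first_col: "i < 2 ^ d \<Longrightarrow> Mmat d $$ (i, 0) = (if i = 0 then 1 else 0)"
  using Mmat_first_row[of 0 d] Mmat_below_diag[of i d 0] by auto

lemma Mmat_last_row: "j < 2 ^ d \<Longrightarrow> Mmat d $$ (2 ^ d - 1, j) = (if j = 2 ^ d - 1 then 1 else 0)"
  using Mmat_diag[of "2 ^ d - 1" d] Mmat_below_diag[of "2 ^ d - 1" d j] by auto

text \<open>Entry (i, j) is the binomial coefficient j over i modulo 2. The rule is inherited inside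
  a quadrant; at quadrant borders it follows from the all-one first row and last column and the unit
  vectors in the first column and last row.\<close>

lemma Mmat_pascal:
  "Suc i < 2 ^ d \<Longrightarrow> Suc j < 2 ^ d \<Longrightarrow>
    Mmat d $$ (Suc i, Suc j) = Mmat d $$ (i, j) + Mmat d $$ (Suc i, j)"
proof (induction d arbitrary: i j)
  case (Suc d)
  let ?h = "2 ^ d :: nat"
  have bounds: "i < 2 ^ Suc d" "Suc i < 2 ^ Suc d" "j < 2 ^ Suc d" "Suc j < 2 ^ Suc d"
    using Suc.prems by auto
  note E = Mmat_Suc_index[OF bounds(2,4)] Mmat_Suc_index[OF bounds(1,3)]
    Mmat_Suc_index[OF bounds(2,3)]
  consider "Suc i < ?h" | "Suc i = ?h" | "i \<ge> ?h" by linarith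
  then show ?case
  proof cases
    case 1
    consider "Suc j < ?h" | "Suc j = ?h" | "j \<ge> ?h" by linarith
    then show ?thesis
    proof cases
      case j: 2
      then have "j = ?h - 1" by simp
      then have "Mmat d $$ (i, j) = 1" "Mmat d $$ (Suc i, j) = 1"
        using 1 Mmat_last_col[of i d] Mmat_last_col[of "Suc i" d] by simp_all
      then show ?thesis
        unfolding E using 1 j Mmat_first_col[of "Suc i" d] by simp
    next
      case 3
      then have "Suc (j - ?h) < ?h" "Suc j - ?h = Suc (j - ?h)" using bounds by auto
      then show ?thesis unfolding E using 1 3 Suc.IH[of i "j - ?h"] by auto
    qed (use 1 Suc.IH[of i j] in \<open>unfold E, auto\<close>)
  next
    case 2
    then have i: "i = ?h - 1" by simp
    consider "Suc j < ?h" | "Suc j = ?h" | "j \<ge> ?h" by linarith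
    then show ?thesis
    proof cases
      case 1
      then show ?thesis unfolding E using 2 Mmat_last_row[of j d] i by auto
    next
      case 2
      then show ?thesis unfolding E
        using \<open>Suc i = ?h\<close> Mmat_last_row[of j d] Mmat_first_row[of 0 d] i by auto
    next
      case 3
      then have "Suc (j - ?h) < ?h" "Suc j - ?h = Suc (j - ?h)" using bounds by auto
      then show ?thesis unfolding E
        using 2 3 i Mmat_last_row[of "j - ?h" d] Mmat_first_row[of "j - ?h" d]
          Mmat_first_row[of "Suc (j - ?h)" d] by auto
    qed
  next
    case 3
    then have i: "Suc (i - ?h) < ?h" "Suc i - ?h = Suc (i - ?h)" using bounds by auto
    consider "Suc j < ?h" | "Suc j = ?h" | "j \<ge> ?h" by linarith
    then show ?thesis
    proof cases
      case 3
      then have "Suc (j - ?h) < ?h" "Suc j - ?h = Suc (j - ?h)" using bounds by auto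
      then show ?thesis unfolding E using 3 \<open>?h \<le> i\<close> i Suc.IH[of "i - ?h" "j - ?h"] by auto
    qed (use 3 i Mmat_first_col[of "Suc (i - ?h)" d] in \<open>unfold E, auto\<close>)
  qed
qed simp

text \<open>At the wrap from the last row to row 0 the rule reads 1 = 0 + 1. Thus multiplication by
  1 + x modulo x^m + 1 leads from each column to the next.\<close>

lemma Mmat_pascal_cyclic:
  assumes "Suc j < 2 ^ d"
  shows "Mmat d $$ (Suc i mod 2 ^ d, Suc j) = Mmat d $$ (i mod 2 ^ d, j) + Mmat d $$ (Suc i mod 2 ^ d, j)"
proof (cases "Suc (i mod 2 ^ d) = 2 ^ d")
  case True
  then have "Suc i mod 2 ^ d = 0" by (simp add: mod_Suc)
  moreover have "i mod 2 ^ d = 2 ^ d - 1" using True by simp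
  ultimately show ?thesis
    using assms Mmat_first_row[of j d] Mmat_first_row[of "Suc j" d] Mmat_last_row[of j d] by simp
next
  case False
  then have "Suc i mod 2 ^ d = Suc (i mod 2 ^ d)" by (simp add: mod_Suc)
  moreover have "Suc (i mod 2 ^ d) < 2 ^ d"
    using False mod_less_divisor[of "2 ^ d" i] by (simp add: Suc_lessI)
  ultimately show ?thesis using assms Mmat_pascal by simp
qed

section \<open>Cyclically shifted columns\<close>

text \<open>Column \<open>j\<close> is counted from the right, so that it is weighted by the binary digit \<open>j\<close> of a
  block number, and is read as an \<open>m\<close>-periodic sequence.\<close>

definition scol :: "nat \<Rightarrow> nat \<Rightarrow> nat \<Rightarrow> nat \<Rightarrow> bit" where
  "scol d j s i = Mmat d $$ ((i + (2 ^ d - s)) mod 2 ^ d, 2 ^ d - 1 - j)"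

lemma scol_periodic [simp]: "scol d j s (i + 2 ^ d) = scol d j s i"
  by (simp add: scol_def add.commute[of i] add.assoc)

lemma scol_mod [simp]: "scol d j s (i mod 2 ^ d) = scol d j s i"
  by (simp add: scol_def mod_add_left_eq)

text \<open>The unshifted column ends in \<open>j\<close> zeros below the diagonal; the shift moves
  \<open>s\<close> of them to the start and leaves \<open>j - s\<close> at the end.\<close>

lemma scol_zero_start: "s \<le> j \<Longrightarrow> j < 2 ^ d \<Longrightarrow> i < s \<Longrightarrow> scol d j s i = 0"
  unfolding scol_def by (rule Mmat_below_diag) auto

lemma scol_shift_index: "s \<le> i \<Longrightarrow> i < 2 ^ d \<Longrightarrow> (i + (2 ^ d - s)) mod 2 ^ d = i - s" for i s :: nat
proof -
  assume "s \<le> i" "i < 2 ^ d"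
  then have "i + (2 ^ d - s) = (i - s) + 2 ^ d" by simp
  then show ?thesis using \<open>i < 2 ^ d\<close> by (simp only: mod_add_self2) simp
qed

lemma scol_zero_end:
  assumes "s \<le> j" "j < 2 ^ d" "i < 2 ^ d" "2 ^ d - (j - s) \<le> i"
  shows "scol d j s i = 0"
proof -
  have "s \<le> i" using assms by linarith
  then show ?thesis
    unfolding scol_def using assms by (subst scol_shift_index) (auto intro!: Mmat_below_diag)
qed

lemma scol_one_start: "s \<le> j \<Longrightarrow> j < 2 ^ d \<Longrightarrow> scol d j s s = 1"
  unfolding scol_def by (subst scol_shift_index) (auto intro!: Mmat_first_row)

lemma scol_one_end: "s \<le> j \<Longrightarrow> j < 2 ^ d \<Longrightarrow> scol d j s (2 ^ d - 1 - (j - s)) = 1"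
  unfolding scol_def by (subst scol_shift_index) (auto intro!: Mmat_diag)

lemma scol_0: "scol d 0 s i = 1"
  unfolding scol_def using Mmat_last_col by simp

lemma scol_Suc_diff:
  assumes "Suc j < 2 ^ d"
  shows "scol d (Suc j) s i + scol d (Suc j) s (Suc i) = scol d j s (Suc i)"
proof -
  have "Suc (2 ^ d - 1 - Suc j) = 2 ^ d - 1 - j" using assms by simp
  then show ?thesis
    using Mmat_pascal_cyclic[of "2 ^ d - 1 - Suc j" d "i + (2 ^ d - s)"] assms
    unfolding scol_def by simp
qed

text \<open>Pascal's rule read across shifts. It will link the two admissible shifts of a new column
  with a rotation by half the length.\<close>

lemma scol_add_shift:
  assumes "Suc j < 2 ^ d" "s < 2 ^ d"
  shows "scol d (Suc j) s i + scol d (Suc j) (Suc s) i = scol d j s i"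
proof -
  have "Suc (2 ^ d - 1 - Suc j) = 2 ^ d - 1 - j" "2 ^ d - s = Suc (2 ^ d - Suc s)"
    using assms by simp_all
  then show ?thesis
    using Mmat_pascal_cyclic[of "2 ^ d - 1 - Suc j" d "i + (2 ^ d - Suc s)"] assms
    unfolding scol_def by (simp add: add.commute)
qed

section \<open>The difference operator\<close>

definition Del :: "(nat \<Rightarrow> bit) \<Rightarrow> nat \<Rightarrow> bit" where
  "Del g i = g i + g (Suc i)"

lemma Del_pow_shift: "(Del ^^ K) (\<lambda>i. g (Suc i)) i = (Del ^^ K) g (Suc i)"
  by (induction K arbitrary: i) (simp_all add: Del_def)

lemma Del_pow_add: "(Del ^^ K) (\<lambda>i. g i + h i) i = (Del ^^ K) g i + (Del ^^ K) h i"
  by (induction K arbitrary: i) (simp_all add: Del_def add_ac)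

lemma Del_pow_scale: "(Del ^^ K) (\<lambda>i. a * g i) i = a * (Del ^^ K) g i"
  by (induction K arbitrary: i) (simp_all add: Del_def distrib_left)

lemma Del_pow_sum: "(Del ^^ K) (\<lambda>i. \<Sum>j\<in>A. g j i) i = (\<Sum>j\<in>A. (Del ^^ K) (g j) i)"
  by (induction K arbitrary: i) (simp_all add: Del_def sum.distrib)

lemma Del_pow_mono:
  assumes "\<And>i. (Del ^^ K) g i = 0" "K \<le> K'"
  shows "(Del ^^ K') g i = 0"
  using assms(2) by (induction K' arbitrary: i rule: dec_induct) (simp_all add: assms(1) Del_def)

text \<open>By induction \<open>Del g\<close> vanishes from \<open>p\<close> on, so \<open>g\<close>
  is constant from there, and the window makes this constant 0.\<close>

lemma Del_pow_zero_window:
  assumes "\<And>i. (Del ^^ K) g i = 0" "\<And>i. p \<le> i \<Longrightarrow> i < p + K \<Longrightarrow> g i = 0" "p \<le> i"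
  shows "g i = 0"
  using assms
proof (induction K arbitrary: g i)
  case (Suc K)
  have D: "Del g n = 0" if "p \<le> n" for n
    by (rule Suc.IH) (use Suc.prems that in \<open>auto simp: funpow_Suc_right Del_def simp del: funpow.simps\<close>)
  show ?case
    using \<open>p \<le> i\<close>
  proof (induction i rule: dec_induct)
    case base
    show ?case using Suc.prems by simp
  next
    case (step n)
    then show ?case using D[of n] by (simp add: Del_def)
  qed
qed simp

lemma Del_pow_scol: "j < 2 ^ d \<Longrightarrow> (Del ^^ j) (scol d j s) i = 1"
proof (induction j arbitrary: i)
  case (Suc j)
  have "Del (scol d (Suc j) s) = (\<lambda>i. scol d j s (Suc i))"
    using Suc.prems by (auto simp: Del_def scol_Suc_diff)
  then show ?case
    using Suc by (simp add: funpow_Suc_right Del_pow_shift del: funpow.simps)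
qed (simp add: scol_0)

lemma Del_pow_scol_eq_0: "j < 2 ^ d \<Longrightarrow> j < K \<Longrightarrow> (Del ^^ K) (scol d j s) i = 0"
  by (rule Del_pow_mono[of "Suc j"]) (simp_all add: Del_pow_scol Del_def)

lemma Del_pow_sum_scol:
  assumes "K \<le> 2 ^ d"
  shows "(Del ^^ K) (\<lambda>i. \<Sum>j<K. a j * scol d j (N j) i) i = 0"
  using assms by (simp add: Del_pow_sum Del_pow_scale Del_pow_scol_eq_0)

text \<open>Applying \<open>Del\<close> as often as the top index kills all lower columns and
  isolates the top coefficient. With \<open>T = 0\<close> this is linear independence of the
  columns.\<close>

lemma sum_scol_top_coeff_zero:
  assumes "\<And>i. (Del ^^ T) (\<lambda>i. \<Sum>j<K. a j * scol d j (N j) i) i = 0"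
    and "K \<le> 2 ^ d" "T \<le> j" "j < K"
  shows "a j = 0"
  using assms
proof (induction K)
  case (Suc K)
  let ?g = "\<lambda>K i. \<Sum>j<K. a j * scol d j (N j) i"
  have "T \<le> K" using Suc.prems by simp
  have "(Del ^^ K) (?g (Suc K)) 0 = 0"
    by (rule Del_pow_mono[OF _ \<open>T \<le> K\<close>]) (use Suc.prems in simp)
  moreover have "(Del ^^ K) (?g (Suc K)) 0 = (Del ^^ K) (?g K) 0 + a K"
    using Suc.prems by (simp add: Del_pow_add Del_pow_scale Del_pow_scol)
  ultimately have aK: "a K = 0"
    using Suc.prems Del_pow_sum_scol[of K d a N 0] by simp
  then show ?case
    using Suc by (cases "j = K") auto
qed simp

text \<open>The shifts read from the right. Having all naturals as domain lets a profile be extended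
  one column at a time.\<close>

definition valid_profile :: "(nat \<Rightarrow> nat) \<Rightarrow> bool" where
  "valid_profile N \<longleftrightarrow> N 0 = 0 \<and> (\<forall>j. N (Suc j) = N j \<or> N (Suc j) = Suc (N j))"

lemma valid_profile_mono:
  assumes "valid_profile N" "i \<le> j"
  shows "N i \<le> N j"
  using assms(2)
proof (induction j rule: dec_induct)
  case (step n)
  then show ?case using assms(1) unfolding valid_profile_def by (metis le_SucI)
qed simp

text \<open>This controls the zeros at the end of column \<open>j\<close>, whose number
  \<open>j - N j\<close> grows by 0 or 1 per step; addition avoids truncated subtraction.\<close>

lemma valid_profile_diff_mono:
  assumes "valid_profile N" "i \<le> j"
  shows "N j + i \<le> N i + j"
  using assms(2)
proof (induction j rule: dec_induct)
  case (step n)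
  moreover have "N (Suc n) \<le> Suc (N n)" using assms(1) unfolding valid_profile_def by (metis le_SucI le_refl)
  ultimately show ?case by linarith
qed simp

lemma valid_profile_le: "valid_profile N \<Longrightarrow> N j \<le> j"
  using valid_profile_diff_mono[of N 0 j] by (simp add: valid_profile_def)

text \<open>The column \<open>j0\<close> has \<open>N j0\<close> zeros at the start and \<open>j0 - N j0\<close> at the end, and every further
  column has at least as many on both sides and strictly more on one of them.\<close>

lemma lowest_coeff_visible:
  assumes N: "valid_profile N" and "K \<le> 2 ^ d" "j0 < K"
  obtains r where "r = N j0 \<or> r = 2 ^ d - 1 - (j0 - N j0)"
    and "\<And>a. (\<And>j. j < j0 \<Longrightarrow> a j = 0) \<Longrightarrow> a j0 = 1 \<Longrightarrow>
      (\<Sum>j<K. a j * scol d j (N j) r) = 1"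
proof -
  have Nle: "N j \<le> j" for j using N by (rule valid_profile_le)
  have sum1: "(\<Sum>j<K. a j * scol d j (N j) r) = 1"
    if "\<And>j. j < j0 \<Longrightarrow> a j = 0" "a j0 = 1" "scol d j0 (N j0) r = 1"
      "\<And>j. j0 < j \<Longrightarrow> j < K \<Longrightarrow> scol d j (N j) r = 0" for a r
  proof -
    have "(\<Sum>j<K. a j * scol d j (N j) r) = (\<Sum>j\<in>{j0}. a j * scol d j (N j) r)"
      by (rule sum.mono_neutral_right) (use that assms in \<open>auto simp: neq_iff\<close>)
    then show ?thesis using that by simp
  qed
  show thesis
  proof (cases "N (Suc j0) = Suc (N j0)")
    case True
    have "scol d j (N j) (N j0) = 0" if "j0 < j" "j < K" for j
      using valid_profile_mono[OF N, of "Suc j0" j] that True assms Nle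
      by (intro scol_zero_start) auto
    then show thesis
      using assms Nle by (intro that[of "N j0"] sum1 scol_one_start) auto
  next
    case False
    then have eq: "N (Suc j0) = N j0" using N by (auto simp: valid_profile_def)
    have "scol d j (N j) (2 ^ d - 1 - (j0 - N j0)) = 0" if "j0 < j" "j < K" for j
      using valid_profile_diff_mono[OF N, of "Suc j0" j] that eq assms Nle[of j] Nle[of j0]
      by (intro scol_zero_end) auto
    then show thesis
      using assms Nle by (intro that[of "2 ^ d - 1 - (j0 - N j0)"] sum1 scol_one_end) auto
  qed
qed

text \<open>The window is a suffix of one block, with coefficients \<open>a\<close>, and a prefix of
  the next, with coefficients \<open>b\<close>. Either one part lies within zeros common to all
  columns from \<open>j0\<close> on, so that one combination has \<open>K\<close> consecutive zeros,
  or both candidates for the visible position \<open>r\<close> are in the window.\<close>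

lemma no_common_zero_window:
  fixes a b :: "nat \<Rightarrow> bit"
  assumes N: "valid_profile N" and K: "K \<le> 2 ^ d" "j0 < K" and p: "p < 2 ^ d"
    and a: "\<And>j. j < j0 \<Longrightarrow> a j = 0" "a j0 = 1"
    and b: "\<And>j. j < j0 \<Longrightarrow> b j = 0" "b j0 = 1"
    and e: "\<And>q. p \<le> q \<Longrightarrow> q < p + K \<Longrightarrow> q < 2 ^ d \<Longrightarrow> (\<Sum>j<K. a j * scol d j (N j) q) = 0"
    and f: "\<And>q. 2 ^ d \<le> q \<Longrightarrow> q < p + K \<Longrightarrow> (\<Sum>j<K. b j * scol d j (N j) q) = 0"
  shows False
proof -
  define E where "E a q = (\<Sum>j<K. a j * scol d j (N j) q)" for a q
  have Nle: "N j \<le> j" for j using N by (rule valid_profile_le)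
  \<comment> \<open>\<open>r\<close> is fixed before the coefficients, so it serves both
    \<open>a\<close> and \<open>b\<close>.\<close>
  obtain r where r: "r = N j0 \<or> r = 2 ^ d - 1 - (j0 - N j0)"
    and vis: "\<And>a. (\<And>j. j < j0 \<Longrightarrow> a j = 0) \<Longrightarrow> a j0 = 1 \<Longrightarrow> E a r = 1"
    using lowest_coeff_visible[OF N K] unfolding E_def by blast
  have per: "E a (q + 2 ^ d) = E a q" for a q by (simp add: E_def)
  \<comment> \<open>With \<open>K\<close> consecutive zeros the combination vanishes from
    \<open>p\<close> on, hence by periodicity also at \<open>r\<close>, where it is 1.\<close>
  have full: False if c: "\<And>j. j < j0 \<Longrightarrow> c j = 0" "c j0 = 1"
      and z: "\<And>q. p \<le> q \<Longrightarrow> q < p + K \<Longrightarrow> E c q = 0" for c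
  proof -
    have "E c (r + 2 ^ d) = 0"
      by (rule Del_pow_zero_window[of K _ p])
        (use z p Del_pow_sum_scol[OF K(1)] in \<open>auto simp: E_def\<close>)
    then show False using per vis[of c] c by simp
  qed
  consider "p + K \<le> 2 ^ d + N j0" | "2 ^ d - p \<le> j0 - N j0"
    | "2 ^ d + N j0 < p + K" "j0 - N j0 < 2 ^ d - p" by linarith
  then show False
  proof cases
    case 1
    have "E a q = 0" if "p \<le> q" "q < p + K" for q
    proof (cases "q < 2 ^ d")
      case False
      then obtain q' where q': "q = q' + 2 ^ d" by (metis add.commute le_Suc_ex not_less)
      have "a j * scol d j (N j) q' = 0" if "j < K" for j
      proof (cases "j < j0")
        case False
        then have "N j0 \<le> N j" by (intro valid_profile_mono[OF N]) simp
        then show ?thesis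
          using scol_zero_start[of "N j" j d q'] Nle that K 1 \<open>q < p + K\<close> q' by simp
      qed (use a in simp)
      then have "E a q' = 0" unfolding E_def by (intro sum.neutral) auto
      then show ?thesis using per q' by simp
    qed (use e that in \<open>simp add: E_def\<close>)
    then show False using full a by blast
  next
    case 2
    have "E b q = 0" if "p \<le> q" "q < p + K" for q
    proof (cases "q < 2 ^ d")
      case True
      have "b j * scol d j (N j) q = 0" if "j < K" for j
      proof (cases "j < j0")
        case False
        then have "N j + j0 \<le> N j0 + j" by (intro valid_profile_diff_mono[OF N]) simp
        then have "2 ^ d - (j - N j) \<le> q" using 2 \<open>p \<le> q\<close> p Nle[of j] Nle[of j0] by linarith
        then show ?thesis
          using scol_zero_end[of "N j" j d q] Nle that K True by simp
      qed (use b in simp)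
      then show ?thesis unfolding E_def by (intro sum.neutral) auto
    qed (use f that in \<open>simp add: E_def\<close>)
    then show False using full b by blast
  next
    case 3
    from r show False
    proof
      assume "r = N j0"
      then have "E b (r + 2 ^ d) = 0" unfolding E_def by (intro f) (use 3 in auto)
      then show False using vis[of b] b per by simp
    next
      assume "r = 2 ^ d - 1 - (j0 - N j0)"
      then have "p \<le> r" "r < 2 ^ d" "r < p + K" using 3 p by auto
      then have "E a r = 0" unfolding E_def using e by simp
      then show False using vis[of a] a by simp
    qed
  qed
qed

section \<open>Perfect periodic sequences\<close>

text \<open>The second condition makes the map from positions to pairs of a residue and a window
  injective on a period; as there are \<open>m * 2 ^ k\<close> of each, every pair then occurs
  exactly once.\<close>

definition perfect_seq :: "nat \<Rightarrow> nat \<Rightarrow> (nat \<Rightarrow> bit) \<Rightarrow> bool" where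
  "perfect_seq k m g \<longleftrightarrow> (\<forall>i. g (i + m * 2 ^ k) = g i) \<and>
     (\<forall>i j. i mod m = j mod m \<longrightarrow> (\<forall>t<k. g (i + t) = g (j + t)) \<longrightarrow>
        i mod (m * 2 ^ k) = j mod (m * 2 ^ k))"

lemma periodic_mod:
  fixes g :: "nat \<Rightarrow> 'a"
  assumes "\<And>i. g (i + L) = g i"
  shows "g (n mod L) = g n"
proof -
  have "g (i + c * L) = g i" for i c
  proof (induction c)
    case (Suc c)
    then show ?case using assms[of "i + c * L"] by (simp add: add_ac)
  qed simp
  from this[of "n mod L" "n div L"] show ?thesis by simp
qed

lemma perfect_seq_periodic:
  "perfect_seq k m g \<Longrightarrow> L = m * 2 ^ k \<Longrightarrow> g (i + L) = g i"
  "perfect_seq k m g \<Longrightarrow> L = m * 2 ^ k \<Longrightarrow> g (L + i) = g i"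
  by (simp_all add: perfect_seq_def add.commute)

lemma perfect_seq_mod:
  assumes "perfect_seq k m g" "L = m * 2 ^ k"
  shows "g (i mod L) = g i"
  by (rule periodic_mod) (use perfect_seq_periodic[OF assms] in simp)

lemma perfect_seq_unique:
  assumes "perfect_seq k m g" "L = m * 2 ^ k" "i mod m = j mod m"
    and "\<And>t. t < k \<Longrightarrow> g (i + t) = g (j + t)"
  shows "i mod L = j mod L"
  using assms unfolding perfect_seq_def by blast

lemma perfect_seq_unique_less:
  assumes "perfect_seq k m g" "L = m * 2 ^ k" "i < L" "j < L" "i mod m = j mod m"
    and "\<And>t. t < k \<Longrightarrow> g (i + t) = g (j + t)"
  shows "i = j"
  using perfect_seq_unique[OF assms(1,2,5,6)] assms(3,4) by simp

lemma length_enum_words: "length (enum_words m) = 2 ^ m"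
  by (induction m) simp_all

lemma card_words: "card {v :: word. length v = n} = 2 ^ n"
proof -
  have "distinct (enum_words n)"
    by (induction n) (auto simp: distinct_map)
  then show ?thesis
    using distinct_card[of "enum_words n"] by (simp add: set_enum_words length_enum_words)
qed

lemma perfect_seq_occurs:
  assumes g: "perfect_seq k m g" and L: "L = m * 2 ^ k" and p: "p < m"
  obtains i where "i < L" "i mod m = p" "\<And>t. t < k \<Longrightarrow> g (i + t) = u t"
proof -
  define f where "f i = (i mod m, map (\<lambda>t. g (i + t)) [0..<k])" for i
  define B :: "(nat \<times> word) set" where "B = {..<m} \<times> {xs. length xs = k}"
  have "finite {xs :: word. length xs = k}"
    using set_enum_words[of k] by (metis List.finite_set)
  then have B: "finite B" "card B = L" by (simp_all add: B_def L card_words)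
  have "inj_on f {..<L}"
  proof (rule inj_onI)
    fix i j assume ij: "i \<in> {..<L}" "j \<in> {..<L}" "f i = f j"
    have "g (i + t) = g (j + t)" if "t < k" for t
      using ij that by (auto simp: f_def)
    show "i = j"
      by (rule perfect_seq_unique_less[OF g L]) (use ij in \<open>auto simp: f_def\<close>)
  qed
  then have "card (f ` {..<L}) = L" by (simp add: card_image)
  moreover have "f ` {..<L} \<subseteq> B" using p by (auto simp: f_def B_def)
  ultimately have "f ` {..<L} = B" using B by (metis card_subset_eq)
  moreover have "(p, map u [0..<k]) \<in> B" using p by (simp add: B_def)
  ultimately obtain i where i: "i < L" "f i = (p, map u [0..<k])" by (metis imageE lessThan_iff)
  have "g (i + t) = u t" if "t < k" for t
    using i that by (auto simp: f_def)
  with i show thesis by (intro that[of i]) (auto simp: f_def)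
qed

lemma nat_add_mod_cancel:
  fixes r i j L :: nat
  shows "(r + i) mod L = (r + j) mod L \<longleftrightarrow> i mod L = j mod L"
proof -
  have *: "(r + b) mod L = (r + a) mod L \<longleftrightarrow> b mod L = a mod L" if "a \<le> b" for a b
    using that mod_eq_dvd_iff_nat[of a b L] mod_eq_dvd_iff_nat[of "r + a" "r + b" L] by simp
  show ?thesis using *[of i j] *[of j i] by (cases "i \<le> j") auto
qed

lemma perfect_seq_rotate:
  assumes "perfect_seq k m g"
  shows "perfect_seq k m (\<lambda>i. g (r + i))"
  unfolding perfect_seq_def
proof (intro conjI allI impI)
  fix i j :: nat assume ij: "i mod m = j mod m" "\<forall>t<k. g (r + (i + t)) = g (r + (j + t))"
  have r: "(r + i) mod m = (r + j) mod m" using ij by (simp only: nat_add_mod_cancel)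
  have "(r + i) mod (m * 2 ^ k) = (r + j) mod (m * 2 ^ k)"
    by (rule perfect_seq_unique[OF assms]) (use ij r in \<open>auto simp: add.assoc\<close>)
  then show "i mod (m * 2 ^ k) = j mod (m * 2 ^ k)"
    by (simp only: nat_add_mod_cancel)
qed (use perfect_seq_periodic(1)[OF assms refl] in \<open>simp flip: add.assoc\<close>)

text \<open>Distinct residues of occurrences give injectivity. Conversely, the residues of the
  occurrences of a word are distinct and, by \<open>perfect_seq_occurs\<close>, exhaust
  \<open>{..<m}\<close>, which gives the count.\<close>

lemma perfect_necklace_iff_perfect_seq:
  assumes len: "length v = m * 2 ^ k" and pos: "0 < m" "0 < k"
  shows "perfect_necklace k m (necklace v) \<longleftrightarrow> perfect_seq k m (\<lambda>i. v ! (i mod length v))"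
    (is "_ \<longleftrightarrow> perfect_seq k m ?g")
proof
  assume P: "perfect_necklace k m (necklace v)"
  have "v \<in> necklace v" unfolding necklace_def by (auto intro: exI[of _ 0])
  with P have inj: "i mod m \<noteq> j mod m"
    if "length u = k" "i \<in> occurrences u v" "j \<in> occurrences u v" "i \<noteq> j" for u i j
    using that unfolding perfect_necklace_def by blast
  show "perfect_seq k m ?g"
    unfolding perfect_seq_def
  proof (intro conjI allI impI)
    fix i j :: nat assume ij: "i mod m = j mod m" "\<forall>t<k. ?g (i + t) = ?g (j + t)"
    define u where "u = map (\<lambda>t. ?g (i + t)) [0..<k]"
    have "i mod length v \<in> occurrences u v" "j mod length v \<in> occurrences u v"
      using ij len pos by (auto simp: occurrences_def u_def mod_add_left_eq)
    moreover have "i mod length v mod m = j mod length v mod m"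
      using ij by (simp add: len mod_mod_cancel)
    ultimately have "i mod length v = j mod length v"
      using inj[of u] by (auto simp: u_def)
    then show "i mod (m * 2 ^ k) = j mod (m * 2 ^ k)" by (simp add: len)
  qed (simp add: len)
next
  assume g: "perfect_seq k m ?g"
  have "card (occurrences u v') = m \<and> (\<forall>i \<in> occurrences u v'. \<forall>j \<in> occurrences u v'.
      i \<noteq> j \<longrightarrow> i mod m \<noteq> j mod m)" if v': "v' \<in> necklace v" and u: "length u = k" for v' u
  proof -
    from v' obtain r where r: "v' = rotate r v" by (auto simp: necklace_def)
    have len': "length v' = m * 2 ^ k" by (simp add: r len)
    have nth: "v' ! (n mod (m * 2 ^ k)) = ?g (r + n)" for n
    proof -
      have "n mod length v < length v" using len pos by simp
      then show ?thesis by (simp add: r nth_rotate mod_add_right_eq flip: len)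
    qed
    note g' = perfect_seq_rotate[OF g, of r]
    have inj: "inj_on (\<lambda>i. i mod m) (occurrences u v')"
    proof (rule inj_onI)
      fix i j assume ij: "i \<in> occurrences u v'" "j \<in> occurrences u v'" "i mod m = j mod m"
      show "i = j"
        by (rule perfect_seq_unique_less[OF g' refl])
          (use ij in \<open>auto simp: occurrences_def nth len' u\<close>)
    qed
    have "(\<lambda>i. i mod m) ` occurrences u v' = {..<m}"
    proof (intro equalityI subsetI)
      fix p assume "p \<in> {..<m}"
      then obtain i where "i < m * 2 ^ k" "i mod m = p" "\<And>t. t < k \<Longrightarrow> ?g (r + (i + t)) = u ! t"
        using perfect_seq_occurs[OF g' refl, of p "\<lambda>t. u ! t"] by blast
      then show "p \<in> (\<lambda>i. i mod m) ` occurrences u v'"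
        by (intro image_eqI[of _ _ i]) (auto simp: occurrences_def nth len' u)
    qed (use pos in auto)
    then have "card (occurrences u v') = m" using card_image[OF inj] by simp
    with inj show ?thesis by (auto simp: inj_on_def)
  qed
  then show "perfect_necklace k m (necklace v)"
    unfolding perfect_necklace_def using pos by blast
qed

section \<open>Perfect concatenations\<close>

lemma mod_add_neq:
  fixes i s L :: nat
  assumes "0 < s" "s < L"
  shows "(i + s) mod L \<noteq> i mod L"
  using assms by (auto simp: mod_eq_dvd_iff_nat dest: nat_dvd_not_less)

text \<open>\<open>x\<close> and \<open>y\<close> are two perfect words closed up separately,
  \<open>w\<close> is their concatenation closed up. A window of \<open>w\<close> agrees with one of
  \<open>x\<close> or \<open>y\<close> unless it crosses a multiple of \<open>L\<close>.\<close>

locale perfect_concat =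
  fixes k m :: nat and x y w :: "nat \<Rightarrow> bit" and L :: nat
  assumes km: "k < m" and L: "L = m * 2 ^ k"
    and x: "perfect_seq k m x" and y: "perfect_seq k m y"
    and w: "perfect_seq (Suc k) m w"
    and w_def: "w = (\<lambda>n. if n mod (2 * L) < L then x n else y n)"
begin

lemma m_le_L: "m \<le> L" and L_pos: "0 < L" and two_L: "2 * L = m * 2 ^ Suc k"
  using km by (simp_all add: L)

lemma L_mod_m: "(L + i) mod m = i mod m"
  by (simp add: L)

lemma L_mod_mod: "n mod L mod m = n mod m"
  by (simp add: L mod_mod_cancel)

lemma w_left: "n < L \<Longrightarrow> w n = x n"
  by (simp add: w_def)

lemma w_right: "n < L \<Longrightarrow> w (L + n) = y n"
  using perfect_seq_periodic[OF y L] by (simp add: w_def)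

lemma w_mid: "n < L \<Longrightarrow> w (L + L + n) = x n"
  using perfect_seq_periodic[OF w two_L, of n] by (simp add: w_left flip: mult_2)

text \<open>Positions with equal residue are at least \<open>m > k\<close> apart, so each class has
  at most one position below \<open>L\<close> whose window of \<open>k + 1\<close> letters
  wraps.\<close>

lemma no_wrap:
  assumes "P < L" "L \<le> P + k" "n < L" "n mod m = P mod m" "n \<noteq> P"
  shows "n + k < L"
proof -
  have "m dvd (P - n)" if "n < P" using that assms by (metis mod_eq_dvd_iff_nat less_imp_le)
  moreover have "m dvd (n - P)" if "P < n" using that assms by (metis mod_eq_dvd_iff_nat less_imp_le)
  ultimately have "n + m \<le> P \<or> P + m \<le> n" using assms(5)
    by (metis add.commute dvd_imp_le le_diff_conv2 less_imp_le nat_neq_iff zero_less_diff)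
  then show ?thesis using assms km by linarith
qed

text \<open>A state with its next letter, that is, an edge of the graph of states, which both cycles
  use.\<close>

definition clash :: "nat \<Rightarrow> nat \<Rightarrow> bool" where
  "clash i j \<longleftrightarrow> i < L \<and> j < L \<and> i mod m = j mod m \<and> (\<forall>t\<le>k. x (i + t) = y (j + t))"

text \<open>If neither window wrapped, \<open>w\<close> would read the same \<open>k + 1\<close>
  letters at \<open>i\<close> and \<open>L + j\<close>. So one of them wraps, and \<open>P\<close>
  is its start.\<close>

lemma clash_position:
  assumes c: "clash i j"
  obtains P where "P < L" "L \<le> P + k" "i mod m = P mod m" "i = P \<or> j = P"
    "\<And>t. t < P + k - L \<Longrightarrow> x t = y t" "x (P + k - L) \<noteq> y (P + k - L)"
proof -
  have ij: "i < L" "j < L" "i mod m = j mod m" "\<And>t. t \<le> k \<Longrightarrow> x (i + t) = y (j + t)"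
    using c by (auto simp: clash_def)
  have "L \<le> i + k \<or> L \<le> j + k"
  proof (rule ccontr)
    assume nw: "\<not> ?thesis"
    have "i = L + j"
      by (rule perfect_seq_unique_less[OF w two_L])
        (use nw ij L_mod_m in \<open>auto simp: w_left w_right add.assoc\<close>)
    then show False using ij by simp
  qed
  then obtain P where P: "P < L" "L \<le> P + k" "i mod m = P mod m" "i = P \<or> j = P"
    using ij by metis
  have nw: "n + k < L" if "n < L" "n mod m = P mod m" "n \<noteq> P" for n
    using no_wrap[OF P(1,2)] that by blast
  \<comment> \<open>Perfectness of \<open>w\<close> also provides the shared \<open>k\<close>
    letters followed by the other letter.\<close>
  obtain q where q: "q < 2 * L" "q mod m = P mod m"
    "\<And>t. t < Suc k \<Longrightarrow> w (q + t) = (if t < k then x (i + t) else x (i + k) + 1)"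
    using perfect_seq_occurs[OF w two_L, of "P mod m" "\<lambda>t. if t < k then x (i + t) else x (i + k) + 1"]
      km by auto
  have q1: "w (q + t) = x (i + t)" if "t < k" for t using q(3)[of t] that by simp
  have q2: "w (q + k) \<noteq> x (i + k)" using q(3)[of k] by simp
  have xwrap: "x (P + t) = x (P + t - L)" and ywrap: "y (P + t) = y (P + t - L)"
    if "L \<le> P + t" for t
    using perfect_seq_periodic(2)[OF x L, of "P + t - L"] perfect_seq_periodic(2)[OF y L, of "P + t - L"]
      that by simp_all
  have Pk: "P + k - L < L" using P km m_le_L by linarith
  \<comment> \<open>Elsewhere the window of \<open>w\<close> lies inside \<open>x\<close> or
    \<open>y\<close>, where the \<open>k\<close> letters occur only at \<open>i\<close> or
    \<open>j\<close>, followed by the shared letter.\<close>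
  have "q = P \<or> q = L + P"
  proof (rule ccontr)
    assume neq: "\<not> ?thesis"
    show False
    proof (cases "q < L")
      case True
      then have "q + k < L" using nw q neq by simp
      then have eq: "w (q + t) = x (q + t)" if "t \<le> k" for t using that by (simp add: w_left)
      have "q = i"
        by (rule perfect_seq_unique_less[OF x L]) (use True ij P q q1 eq in auto)
      then show False using eq[of k] q2 by simp
    next
      case False
      then obtain q' where q': "q = L + q'" by (metis le_Suc_ex not_less)
      have r: "q' mod m = P mod m" "q' < L" using q q' L_mod_m by auto
      then have "q' + k < L" using nw q' neq by simp
      then have eq: "w (q + t) = y (q' + t)" if "t \<le> k" for t
        using that by (simp add: w_right q' add.assoc)
      have "q' = j"
        by (rule perfect_seq_unique_less[OF y L]) (use r ij P q1 eq in auto)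
      then show False using eq[of k] q2 ij by simp
    qed
  qed
  then show thesis
  proof
    assume "q = P"
    have wq: "w (q + t) = y (P + t - L)" if "L \<le> P + t" "t \<le> k" for t
      using w_right[of "P + t - L"] that Pk \<open>q = P\<close> by simp
    from P(4) show thesis
    proof
      assume "i = P"
      \<comment> \<open>From \<open>P\<close>, \<open>w\<close> continues into \<open>y\<close>
        where the closed-up \<open>x\<close> returns to its own start; so the prefixes agree until
        the differing letter.\<close>
      have "x t = y t" if "t < P + k - L" for t
        using wq[of "t + L - P"] q1[of "t + L - P"] xwrap[of "t + L - P"] that P \<open>i = P\<close> by simp
      moreover have "x (P + k - L) \<noteq> y (P + k - L)"
        using wq[of k] q2 xwrap[of k] P \<open>i = P\<close> by simp
      ultimately show thesis using that P by blast
    next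
      assume "j = P"
      then show thesis using wq[of k] q2 ywrap[of k] P ij(4)[of k] by simp
    qed
  next
    assume "q = L + P"
    have wq: "w (q + t) = x (P + t - L)" if "L \<le> P + t" "t \<le> k" for t
      using w_mid[of "P + t - L"] that Pk \<open>q = L + P\<close> by (simp add: add.assoc)
    from P(4) show thesis
    proof
      assume "j = P"
      have "x t = y t" if "t < P + k - L" for t
        using wq[of "t + L - P"] q1[of "t + L - P"] ywrap[of "t + L - P"] ij(4)[of "t + L - P"]
          that P \<open>j = P\<close> by simp
      moreover have "x (P + k - L) \<noteq> y (P + k - L)"
        using wq[of k] q2 ywrap[of k] P \<open>j = P\<close> ij(4)[of k] by simp
      ultimately show thesis using that P by blast
    next
      assume "i = P"
      then show thesis using wq[of k] q2 xwrap[of k] P by simp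
    qed
  qed
qed

text \<open>If the suffixes differed, the word read across the boundary after the first letter would
  occur three times at the same residue, leaving three distinct letters to follow it.\<close>

lemma suffixes_agree:
  assumes P: "P < L" "L \<le> P + k" and ne: "x (P + k - L) \<noteq> y (P + k - L)"
    and n: "P < n" "n < L"
  shows "x n = y n"
proof (rule ccontr)
  assume neq: "x n \<noteq> y n"
  define Q where "Q = Suc P"
  have Q: "Q < L" "L \<le> Q + k" "Q \<le> n" using P n by (auto simp: Q_def)
  have Qk: "Q + k \<le> L + L" using Q km m_le_L by linarith
  obtain i where i: "i < L" "i mod m = Q mod m" "\<And>t. t < k \<Longrightarrow> x (i + t) = w (Q + t)"
    using perfect_seq_occurs[OF x L, of "Q mod m" "\<lambda>t. w (Q + t)"] km by auto
  obtain j where j: "j < L" "j mod m = Q mod m" "\<And>t. t < k \<Longrightarrow> y (j + t) = w (Q + t)"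
    using perfect_seq_occurs[OF y L, of "Q mod m" "\<lambda>t. w (Q + t)"] km by auto
  have k: "0 < k" using P by simp
  have Pk: "P + k - L < L" using P km m_le_L by linarith
  have "i \<noteq> Q"
  proof
    assume "i = Q"
    then have "x (P + k) = w (P + k)" using i(3)[of "k - 1"] k by (simp add: Q_def)
    moreover have "x (P + k) = x (P + k - L)"
      using perfect_seq_periodic(2)[OF x L, of "P + k - L"] P by simp
    moreover have "w (P + k) = y (P + k - L)" using w_right[OF Pk] P by simp
    ultimately show False using ne by simp
  qed
  then have ik: "i + k < L" using no_wrap[OF Q(1,2)] i by blast
  have "j \<noteq> Q"
  proof
    assume "j = Q"
    then have "y n = w n" using j(3)[of "n - Q"] Q n P by (simp add: Q_def)
    then show False using neq w_left n by simp
  qed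
  then have jk: "j + k < L" using no_wrap[OF Q(1,2)] j by blast
  have uniq: "a = b" if "a < 2 * L" "b < 2 * L" "a mod m = Q mod m" "b mod m = Q mod m"
    "\<And>t. t < k \<Longrightarrow> w (a + t) = w (Q + t)" "\<And>t. t < k \<Longrightarrow> w (b + t) = w (Q + t)"
    "w (a + k) = w (b + k)" for a b
  proof (rule perfect_seq_unique_less[OF w two_L])
    fix t assume "t < Suc k"
    then show "w (a + t) = w (b + t)" using that(5-7) by (cases "t = k") auto
  qed (use that in auto)
  have wi: "w (i + t) = w (Q + t)" if "t < k" for t
    using i that ik by (simp add: w_left)
  have wj: "w (L + j + t) = w (Q + t)" if "t < k" for t
    using j that jk w_right[of "j + t"] by (simp add: add.assoc)
  have "w (i + k) \<noteq> w (Q + k)" using uniq[of i Q] wi i Q \<open>i \<noteq> Q\<close> by auto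
  moreover have "w (L + j + k) \<noteq> w (Q + k)" using uniq[of "L + j" Q] wj j Q L_mod_m by auto
  moreover have "w (i + k) \<noteq> w (L + j + k)" using uniq[of i "L + j"] wi wj i j L_mod_m by auto
  ultimately show False by (metis (full_types) bit.exhaust)
qed

text \<open>\<open>P + k - L\<close> is the first place where \<open>x\<close> and \<open>y\<close>
  differ, so \<open>P\<close> is the same for all clashes. From \<open>P\<close>, both read the same
  letters at offsets strictly between 0 and \<open>k\<close>, by the equal suffixes and
  prefixes.\<close>

lemma clash_unique_tail:
  assumes "clash i j" "clash i' j'"
  shows "i mod m = i' mod m" "\<And>t. 0 < t \<Longrightarrow> t < k \<Longrightarrow> x (i + t) = x (i' + t)" "0 < k"
proof -
  obtain P where P: "P < L" "L \<le> P + k" "i mod m = P mod m" "i = P \<or> j = P"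
    "\<And>t. t < P + k - L \<Longrightarrow> x t = y t" "x (P + k - L) \<noteq> y (P + k - L)"
    using clash_position[OF assms(1)] by blast
  obtain P' where P': "P' < L" "L \<le> P' + k" "i' mod m = P' mod m" "i' = P' \<or> j' = P'"
    "\<And>t. t < P' + k - L \<Longrightarrow> x t = y t" "x (P' + k - L) \<noteq> y (P' + k - L)"
    using clash_position[OF assms(2)] by blast
  have "P + k - L = P' + k - L" using P(5,6) P'(5,6) by (metis nat_neq_iff)
  then have PP: "P = P'" using P P' by linarith
  show "i mod m = i' mod m" using P P' PP by simp
  show "0 < k" using P by simp
  have tail: "x (P + t) = y (P + t)" if t: "0 < t" "t < k" for t
  proof (cases "P + t < L")
    case True
    then show ?thesis using suffixes_agree[OF P(1,2,6)] t by simp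
  next
    case False
    then show ?thesis
      using perfect_seq_periodic(2)[OF x L, of "P + t - L"]
        perfect_seq_periodic(2)[OF y L, of "P + t - L"] P(5)[of "P + t - L"] t by auto
  qed
  have "x (i0 + t) = x (P + t)" if "clash i0 j0" "i0 = P \<or> j0 = P" "0 < t" "t < k" for i0 j0 t
    using that tail[of t] by (auto simp: clash_def)
  then show "x (i + t) = x (i' + t)" if "0 < t" "t < k" for t
    using assms P(4) P'(4) PP that by metis
qed

text \<open>A clash means that \<open>y\<close> follows the transitions of \<open>z\<close> except that those of two states
  differing only in their first letter are exchanged; this would split the cycle of \<open>z\<close>.\<close>

lemma no_clash:
  assumes z: "perfect_seq k m z"
    and compl: "\<And>i j. i mod m = j mod m \<Longrightarrow> (\<And>t. t < k \<Longrightarrow> x (i + t) = z (j + t)) \<Longrightarrow>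
      x (i + k) \<noteq> z (j + k)"
  shows "\<not> clash i j"
proof
  assume c: "clash i j"
  have ij: "i < L" "j < L" "i mod m = j mod m" "\<And>t. t \<le> k \<Longrightarrow> x (i + t) = y (j + t)"
    using c by (auto simp: clash_def)
  have k: "0 < k" by (rule clash_unique_tail(3)[OF c c])
  \<comment> \<open>\<open>q\<close> and \<open>q'\<close> are the positions in \<open>z\<close> of
    the two states that differ only in the first letter.\<close>
  obtain q where q: "q < L" "q mod m = i mod m" "\<And>t. t < k \<Longrightarrow> z (q + t) = x (i + t)"
    using perfect_seq_occurs[OF z L, of "i mod m" "\<lambda>t. x (i + t)"] km by auto
  obtain q' where q': "q' < L" "q' mod m = i mod m"
    "\<And>t. t < k \<Longrightarrow> z (q' + t) = (if t = 0 then x i + 1 else x (i + t))"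
    using perfect_seq_occurs[OF z L, of "i mod m" "\<lambda>t. if t = 0 then x i + 1 else x (i + t)"] km
    by auto
  have "q \<noteq> q'" using q(3)[of 0] q'(3)[of 0] k by auto
  have zq: "z (q + k) \<noteq> x (i + k)" using compl[of i q] q by fastforce
  \<comment> \<open>With equal next letters \<open>z\<close> would have the same state at
    \<open>Suc q\<close> and \<open>Suc q'\<close>.\<close>
  have zq': "z (q' + k) = x (i + k)"
  proof (rule ccontr)
    assume "z (q' + k) \<noteq> x (i + k)"
    then have eq: "z (q + k) = z (q' + k)" using zq by (metis (full_types) bit.exhaust)
    have "Suc q mod L = Suc q' mod L"
    proof (rule perfect_seq_unique[OF z L])
      show "Suc q mod m = Suc q' mod m" using q q' nat_add_mod_cancel[of 1 q m q'] by simp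
      show "z (Suc q + t) = z (Suc q' + t)" if "t < k" for t
        using q(3)[of "Suc t"] q'(3)[of "Suc t"] eq that by (cases "Suc t = k") auto
    qed
    then have "q mod L = q' mod L" using nat_add_mod_cancel[of 1 q L q'] by simp
    then show False using q q' \<open>q \<noteq> q'\<close> by simp
  qed
  \<comment> \<open>The next copy of \<open>q\<close> after \<open>q'\<close>; strictly between
    \<open>q'\<close> and \<open>Q\<close>, \<open>z\<close> visits neither of the two
    states.\<close>
  define Q where "Q = (if q' < q then q else q + L)"
  have Q: "q' < Q" "Q < q' + L" "Q mod L = q" "Q mod m = i mod m"
    using q q' \<open>q \<noteq> q'\<close> L_mod_m[of q] by (auto simp: Q_def add.commute)
  have zQ: "z (Q + t) = z (q + t)" for t
    using perfect_seq_periodic(1)[OF z L, of "q + t"] by (auto simp: Q_def add_ac)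
  have follow: "\<forall>t<k. y (j + s + t) = z (q' + s + t)" if "1 \<le> s" "s \<le> Q - q'" for s
    using that
  proof (induction s rule: dec_induct)
    case base
    have "y (j + 1 + t) = z (q' + 1 + t)" if "t < k" for t
      using ij(4)[of "Suc t"] q'(3)[of "Suc t"] zq' that by (cases "Suc t = k") auto
    then show ?case by blast
  next
    case (step s)
    then have IH: "\<And>t. t < k \<Longrightarrow> y (j + s + t) = z (q' + s + t)" and s: "1 \<le> s" "q' + s < Q" by auto
    have res: "(q' + s) mod m = (j + s) mod m" using q' ij by (metis mod_add_left_eq)
    \<comment> \<open>Leaving \<open>z\<close> would be a further clash, and by
      \<open>clash_unique_tail\<close> the state of \<open>z\<close> at \<open>q' + s\<close> would
      be one of the two.\<close>
    have last: "y (j + s + k) = z (q' + s + k)"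
    proof (rule ccontr)
      assume neq: "y (j + s + k) \<noteq> z (q' + s + k)"
      obtain i2 where i2: "i2 < L" "i2 mod m = (j + s) mod m"
        "\<And>t. t < k \<Longrightarrow> x (i2 + t) = y (j + s + t)"
        using perfect_seq_occurs[OF x L, of "(j + s) mod m" "\<lambda>t. y (j + s + t)"] km by auto
      have "x (i2 + k) \<noteq> z (q' + s + k)" using i2 IH res by (intro compl) auto
      then have "x (i2 + k) = y (j + s + k)" using neq by (metis (full_types) bit.exhaust)
      then have all: "x (i2 + t) = y (j + s + t)" if "t \<le> k" for t
        using i2(3)[of t] that by (cases "t = k") auto
      have "y ((j + s) mod L + t) = y (j + s + t)" for t
        using perfect_seq_mod[OF y L] by (metis mod_add_left_eq)
      then have c2: "clash i2 ((j + s) mod L)"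
        using i2 all L_pos unfolding clash_def by (auto simp: L_mod_mod)
      have r: "(q' + s) mod m = i mod m"
        using clash_unique_tail(1)[OF c2 c] i2 res by simp
      have tl: "z (q' + s + t) = x (i + t)" if "0 < t" "t < k" for t
        using clash_unique_tail(2)[OF c2 c that] i2(3)[of t] IH[of t] that by simp
      show False
      proof (cases "z (q' + s) = x i")
        case True
        have "(q' + s) mod L = Q mod L"
        proof (rule perfect_seq_unique[OF z L])
          show "z (q' + s + t) = z (Q + t)" if "t < k" for t
            using tl[of t] True zQ[of t] q(3)[of t] that by (cases t) auto
        qed (use r Q in simp)
        moreover have "Q - (q' + s) < L" using s Q by linarith
        ultimately show False
          using mod_add_neq[of "Q - (q' + s)" L "q' + s"] s by simp
      next
        case False
        then have F: "z (q' + s) = x i + 1" by (cases "x i") auto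
        have "(q' + s) mod L = q' mod L"
        proof (rule perfect_seq_unique[OF z L])
          show "z (q' + s + t) = z (q' + t)" if "t < k" for t
            using tl[of t] F q'(3)[of t] that by (cases t) auto
        qed (use r q' in simp)
        then show False
          using mod_add_neq[of s L q'] s Q by auto
      qed
    qed
    have "y (j + Suc s + t) = z (q' + Suc s + t)" if "t < k" for t
      using IH[of "Suc t"] last that by (cases "Suc t = k") auto
    then show ?case by blast
  qed
  \<comment> \<open>At \<open>Q\<close>, \<open>y\<close> is back in its state at \<open>j\<close>
    after fewer than \<open>L\<close> steps: its cycle would split.\<close>
  have "(j + (Q - q')) mod L = j mod L"
  proof (rule perfect_seq_unique[OF y L])
    have "m dvd Q - q'" using Q q' by (metis less_imp_le mod_eq_dvd_iff_nat)
    then show "(j + (Q - q')) mod m = j mod m" by auto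
    show "y (j + (Q - q') + t) = y (j + t)" if "t < k" for t
    proof -
      have "y (j + (Q - q') + t) = z (Q + t)"
        using follow[of "Q - q'"] Q that by simp
      then show ?thesis using zQ[of t] q(3)[of t] ij(4)[of t] that by simp
    qed
  qed
  moreover have "Q - q' < L" using Q by linarith
  ultimately show False using mod_add_neq[of "Q - q'" L j] Q(1) by simp
qed

text \<open>Without clashes \<open>y\<close> uses no edge of \<open>x\<close>, so by complementarity
  it runs along \<open>z\<close> from the position \<open>q\<close> of its first state, a multiple
  of \<open>m\<close>.\<close>

lemma second_half_rotation:
  assumes z: "perfect_seq k m z"
    and compl: "\<And>i j. i mod m = j mod m \<Longrightarrow> (\<And>t. t < k \<Longrightarrow> x (i + t) = z (j + t)) \<Longrightarrow>
      x (i + k) \<noteq> z (j + k)"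
  obtains r where "\<And>n. y n = z (n + r * m)"
proof -
  have step: "y (j + k) = z (q + k)"
    if jq: "j mod m = q mod m" "\<And>t. t < k \<Longrightarrow> y (j + t) = z (q + t)" for j q
  proof (rule ccontr)
    assume neq: "y (j + k) \<noteq> z (q + k)"
    obtain i where i: "i < L" "i mod m = j mod m" "\<And>t. t < k \<Longrightarrow> x (i + t) = y (j + t)"
      using perfect_seq_occurs[OF x L, of "j mod m" "\<lambda>t. y (j + t)"] km by auto
    have "x (i + k) \<noteq> z (q + k)" using i jq by (intro compl) auto
    then have "x (i + k) = y (j + k)" using neq by (metis (full_types) bit.exhaust)
    then have all: "x (i + t) = y (j + t)" if "t \<le> k" for t
      using i(3)[of t] that by (cases "t = k") auto
    have "y (j mod L + t) = y (j + t)" for t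
      using perfect_seq_mod[OF y L] by (metis mod_add_left_eq)
    then have "clash i (j mod L)"
      using i all L_pos unfolding clash_def by (auto simp: L_mod_mod)
    then show False using no_clash[OF z compl] by blast
  qed
  obtain q where q: "q mod m = 0" "\<And>t. t < k \<Longrightarrow> z (q + t) = y t"
    using perfect_seq_occurs[OF z L, of 0 y] km by (metis gr_zeroI less_nat_zero_code)
  have "y n = z (n + q)" for n
  proof (induction n rule: less_induct)
    case (less n)
    show ?case
    proof (cases "n < k")
      case True
      then show ?thesis using q by (simp add: add.commute)
    next
      case False
      then obtain j where j: "n = j + k" by (metis add.commute le_Suc_ex not_less)
      have "y (j + k) = z (j + q + k)"
      proof (rule step)
        show "j mod m = (j + q) mod m" using q(1) by auto
        show "y (j + t) = z (j + q + t)" if "t < k" for t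
          using less[of "j + t"] j that by (simp add: add_ac)
      qed
      then show ?thesis by (simp add: j add_ac)
    qed
  qed
  moreover obtain r where "q = r * m" using q(1) by (metis add.right_neutral div_mult_mod_eq)
  ultimately show thesis using that by blast
qed

end

section \<open>Affine sequences\<close>

definition dig :: "nat \<Rightarrow> nat \<Rightarrow> bit" where
  "dig i j = of_nat (i div 2 ^ j)"

lemma of_nat_bit_eq: "of_nat n = (of_bool (odd n) :: bit)"
  by (induction n) (auto simp: of_bool_def)

lemma mod_power_Suc_eq_iff:
  fixes i i' :: nat
  shows "i mod 2 ^ Suc j = i' mod 2 ^ Suc j \<longleftrightarrow> i mod 2 ^ j = i' mod 2 ^ j \<and> dig i j = dig i' j"
proof -
  have e: "i mod 2 ^ Suc j = 2 ^ j * (i div 2 ^ j mod 2) + i mod 2 ^ j" for i :: nat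
    using mod_mult2_eq[of i "2 ^ j" 2] by (simp add: mult.commute)
  have "i mod 2 ^ j = i' mod 2 ^ j" if "i mod 2 ^ Suc j = i' mod 2 ^ Suc j"
    using that by (metis le_imp_power_dvd lessI less_imp_le mod_mod_cancel)
  moreover have "dig i j = dig i' j \<longleftrightarrow> i div 2 ^ j mod 2 = i' div 2 ^ j mod 2"
    by (auto simp: dig_def of_nat_bit_eq of_bool_def odd_iff_mod_2_eq_one split: if_splits)
  ultimately show ?thesis using e[of i] e[of i'] by auto
qed

lemma dig_cong: "i mod 2 ^ K = i' mod 2 ^ K \<Longrightarrow> j < K \<Longrightarrow> dig i j = dig i' j"
proof (induction K)
  case (Suc K)
  then show ?case using mod_power_Suc_eq_iff[of i K i'] by (cases "j = K") auto
qed simp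

lemma obtain_lowest_dig:
  assumes "i mod 2 ^ K \<noteq> i' mod 2 ^ K"
  obtains j where "j < K" "i mod 2 ^ j = i' mod 2 ^ j" "dig i j \<noteq> dig i' j"
  using assms
proof (induction K)
  case (Suc K)
  then show ?case
    using mod_power_Suc_eq_iff[of i K i'] by (metis lessI less_SucI)
qed simp

lemma Suc_mod_eq_iff: "Suc i mod L = Suc i' mod L \<longleftrightarrow> i mod L = i' mod L"
  using nat_add_mod_cancel[of 1 i L i'] by simp

lemma Suc_lowest_dig:
  assumes "i mod 2 ^ j = i' mod 2 ^ j" "dig i j \<noteq> dig i' j"
  shows "Suc i mod 2 ^ j = Suc i' mod 2 ^ j" "dig (Suc i) j \<noteq> dig (Suc i') j"
  using assms mod_power_Suc_eq_iff[of i j i'] mod_power_Suc_eq_iff[of "Suc i" j "Suc i'"]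
  by (auto simp only: Suc_mod_eq_iff)

text \<open>\<open>n div 2 ^ d\<close> is the block number, whose digits weight the columns;
  \<open>v\<close> is the image of \<open>z\<close> under the matrix, which is the first
  block.\<close>

definition affine_seq :: "nat \<Rightarrow> (nat \<Rightarrow> nat) \<Rightarrow> nat \<Rightarrow> (nat \<Rightarrow> bit) \<Rightarrow> nat \<Rightarrow> bit" where
  "affine_seq d N k v n =
     v (n mod 2 ^ d) + (\<Sum>j<k. dig (n div 2 ^ d) j * scol d j (N j) n)"

lemma scol_periodic_mult [simp]: "scol d j s (i + 2 ^ d * c) = scol d j s i"
  "scol d j s (2 ^ d * c + i) = scol d j s i"
  using scol_mod[of d j s "i + 2 ^ d * c"] scol_mod[of d j s i]
  by (simp_all del: scol_mod add: add.commute)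

lemma affine_seq_cong:
  "(\<And>j. j < k \<Longrightarrow> N j = N' j) \<Longrightarrow> (\<And>p. p < 2 ^ d \<Longrightarrow> v p = v' p) \<Longrightarrow>
    affine_seq d N k v n = affine_seq d N' k v' n"
  by (simp add: affine_seq_def)

lemma affine_seq_periodic: "affine_seq d N k v (n + 2 ^ d * 2 ^ k) = affine_seq d N k v n"
proof -
  have "dig (2 ^ k + n div 2 ^ d) j = dig (n div 2 ^ d) j" if "j < k" for j
    using that by (intro dig_cong[of _ k]) auto
  then show ?thesis by (simp add: affine_seq_def)
qed

lemma affine_seq_block:
  assumes "p < 2 ^ d"
  shows "affine_seq d N k v (2 ^ d * B + p) = v p + (\<Sum>j<k. dig B j * scol d j (N j) p)"
  using assms by (simp add: affine_seq_def)

lemma affine_seq_add: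
  assumes "n mod 2 ^ d = n' mod 2 ^ d"
  shows "affine_seq d N k v n + affine_seq d N k v' n' = v (n mod 2 ^ d) + v' (n mod 2 ^ d) +
    (\<Sum>j<k. (dig (n div 2 ^ d) j + dig (n' div 2 ^ d) j) * scol d j (N j) n)"
proof -
  have "scol d j s n' = scol d j s n" for j s
    using scol_mod[of d j s n'] scol_mod[of d j s n] assms by (simp del: scol_mod)
  then show ?thesis
    using assms by (simp add: affine_seq_def sum.distrib distrib_right add_ac)
qed

text \<open>Carries \<open>no_common_zero_window\<close> over to two aligned positions. The family
  \<open>c\<close> is abstract so as to cover the digit differences both with and without an added
  column.\<close>

lemma windows_differ:
  fixes c :: "nat \<Rightarrow> nat \<Rightarrow> nat \<Rightarrow> bit"
  assumes N: "valid_profile N" and K: "K \<le> 2 ^ d" "j0 < K"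
    and n: "n mod 2 ^ d = n' mod 2 ^ d"
    and c: "\<And>j. j < j0 \<Longrightarrow> c (n div 2 ^ d) (n' div 2 ^ d) j = 0"
      "c (n div 2 ^ d) (n' div 2 ^ d) j0 = 1"
      "\<And>j. j < j0 \<Longrightarrow> c (Suc (n div 2 ^ d)) (Suc (n' div 2 ^ d)) j = 0"
      "c (Suc (n div 2 ^ d)) (Suc (n' div 2 ^ d)) j0 = 1"
    and z: "\<And>t. t < K \<Longrightarrow>
      (\<Sum>j<K. c ((n + t) div 2 ^ d) ((n' + t) div 2 ^ d) j * scol d j (N j) (n + t)) = 0"
  shows False
proof -
  define p B B' where "p = n mod 2 ^ d" and "B = n div 2 ^ d" and "B' = n' div 2 ^ d"
  have nn: "n = 2 ^ d * B + p" "n' = 2 ^ d * B' + p"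
    using n mult_div_mod_eq[of "2 ^ d" n] mult_div_mod_eq[of "2 ^ d" n']
    by (simp_all only: p_def B_def B'_def)
  have p: "p < 2 ^ d" by (simp add: p_def)
  show False
  proof (rule no_common_zero_window[OF N K p, of "c B B'" "c (Suc B) (Suc B')"])
    fix q assume q: "p \<le> q" "q < p + K" "q < 2 ^ d"
    have "n + (q - p) = 2 ^ d * B + q" "n' + (q - p) = 2 ^ d * B' + q" using nn q by auto
    then show "(\<Sum>j<K. c B B' j * scol d j (N j) q) = 0"
      using z[of "q - p"] q by simp
  next
    fix q assume q: "2 ^ d \<le> q" "q < p + K"
    then obtain q' where q': "q = 2 ^ d + q'" using le_Suc_ex by blast
    have "q' < 2 ^ d" using q' q p K by linarith
    moreover have "n + (q - p) = 2 ^ d * Suc B + q'" "n' + (q - p) = 2 ^ d * Suc B' + q'"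
      using nn q q' p by auto
    moreover have "scol d j s q = scol d j s q'" for j s
      using q' by (simp add: add.commute)
    ultimately show "(\<Sum>j<K. c (Suc B) (Suc B') j * scol d j (N j) q) = 0"
      using z[of "q - p"] q p by (simp del: mult_Suc_right)
  qed (use c in \<open>simp_all add: B_def B'_def\<close>)
qed

text \<open>Equal windows make the combination of digit differences vanish on \<open>k\<close>
  positions; its lowest nonzero index is the same for the two blocks and for their
  successors.\<close>

lemma affine_seq_perfect:
  assumes N: "valid_profile N" and k: "k \<le> 2 ^ d"
  shows "perfect_seq k (2 ^ d) (affine_seq d N k v)"
  unfolding perfect_seq_def
proof (intro conjI allI impI)
  fix n n' :: nat
  assume n: "n mod 2 ^ d = n' mod 2 ^ d"
    and eq: "\<forall>t<k. affine_seq d N k v (n + t) = affine_seq d N k v (n' + t)"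
  show "n mod (2 ^ d * 2 ^ k) = n' mod (2 ^ d * 2 ^ k)"
  proof (rule ccontr)
    assume "\<not> ?thesis"
    then have "n div 2 ^ d mod 2 ^ k \<noteq> n' div 2 ^ d mod 2 ^ k"
      using n by (auto simp: mod_mult2_eq)
    then obtain j0 where j0: "j0 < k" "n div 2 ^ d mod 2 ^ j0 = n' div 2 ^ d mod 2 ^ j0"
      "dig (n div 2 ^ d) j0 \<noteq> dig (n' div 2 ^ d) j0" using obtain_lowest_dig by blast
    show False
    proof (rule windows_differ[OF N k j0(1) n, of "\<lambda>B B' j. dig B j + dig B' j"])
      fix t assume "t < k"
      have "(n + t) mod 2 ^ d = (n' + t) mod 2 ^ d" using n by (metis mod_add_left_eq)
      from affine_seq_add[OF this, of N k v v] eq \<open>t < k\<close>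
      show "(\<Sum>j<k. (dig ((n + t) div 2 ^ d) j + dig ((n' + t) div 2 ^ d) j) *
          scol d j (N j) (n + t)) = 0" by simp
    next
      note S = Suc_lowest_dig[OF j0(2,3)]
      show "dig (n div 2 ^ d) j + dig (n' div 2 ^ d) j = 0" if "j < j0" for j
        using dig_cong[OF j0(2) that] by simp
      show "dig (Suc (n div 2 ^ d)) j + dig (Suc (n' div 2 ^ d)) j = 0" if "j < j0" for j
        using dig_cong[OF S(1) that] by simp
      show "dig (n div 2 ^ d) j0 + dig (n' div 2 ^ d) j0 = 1"
        using j0(3) by (simp add: bit_add_eq_1_iff)
      show "dig (Suc (n div 2 ^ d)) j0 + dig (Suc (n' div 2 ^ d)) j0 = 1"
        using S(2) by (simp add: bit_add_eq_1_iff)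
    qed
  qed
qed (rule affine_seq_periodic)

text \<open>The added column has coefficient 1 in the difference, so the lowest nonzero index exists
  even if all digits agree; it is \<open>k\<close> then.\<close>

lemma affine_seq_complement:
  assumes N: "valid_profile N" and k: "k < 2 ^ d"
    and n: "n mod 2 ^ d = n' mod 2 ^ d"
    and eq: "\<And>t. t \<le> k \<Longrightarrow> affine_seq d N k v (n + t) =
      affine_seq d N k (\<lambda>p. v p + scol d k (N k) p) (n' + t)"
  shows False
proof -
  define c where "c B B' j = (if j = k then 1 else dig B j + dig B' j)" for B B' j
  have "\<exists>j0\<le>k. n div 2 ^ d mod 2 ^ j0 = n' div 2 ^ d mod 2 ^ j0 \<and>
    (j0 < k \<longrightarrow> dig (n div 2 ^ d) j0 \<noteq> dig (n' div 2 ^ d) j0)"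
  proof (cases "n div 2 ^ d mod 2 ^ k = n' div 2 ^ d mod 2 ^ k")
    case False
    then obtain j where "j < k" "n div 2 ^ d mod 2 ^ j = n' div 2 ^ d mod 2 ^ j"
      "dig (n div 2 ^ d) j \<noteq> dig (n' div 2 ^ d) j" using obtain_lowest_dig by blast
    then show ?thesis by (intro exI[of _ j] conjI impI) simp_all
  next
    case True
    then show ?thesis by (intro exI[of _ k] conjI impI) simp_all
  qed
  then obtain j0 where j0: "j0 \<le> k" "n div 2 ^ d mod 2 ^ j0 = n' div 2 ^ d mod 2 ^ j0"
    "j0 < k \<Longrightarrow> dig (n div 2 ^ d) j0 \<noteq> dig (n' div 2 ^ d) j0" by blast
  have S: "Suc (n div 2 ^ d) mod 2 ^ j0 = Suc (n' div 2 ^ d) mod 2 ^ j0"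
    using j0(2) by (simp only: Suc_mod_eq_iff)
  have S': "dig (Suc (n div 2 ^ d)) j0 \<noteq> dig (Suc (n' div 2 ^ d)) j0" if "j0 < k"
    using Suc_lowest_dig(2) j0 that by blast
  show False
  proof (rule windows_differ[OF N _ _ n, of "Suc k" j0 c])
    fix t assume "t < Suc k"
    have "(n + t) mod 2 ^ d = (n' + t) mod 2 ^ d" using n by (metis mod_add_left_eq)
    from affine_seq_add[OF this, of N k v "\<lambda>p. v p + scol d k (N k) p"] eq[of t] \<open>t < Suc k\<close>
    have "scol d k (N k) (n + t) = (\<Sum>j<k. (dig ((n + t) div 2 ^ d) j + dig ((n' + t) div 2 ^ d) j) *
        scol d j (N j) (n + t))" by (simp flip: add.assoc)
    also have "\<dots> = (\<Sum>j<k. c ((n + t) div 2 ^ d) ((n' + t) div 2 ^ d) j *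
        scol d j (N j) (n + t))" by (intro sum.cong) (auto simp: c_def)
    finally show "(\<Sum>j<Suc k. c ((n + t) div 2 ^ d) ((n' + t) div 2 ^ d) j *
        scol d j (N j) (n + t)) = 0" by (simp add: c_def)
  next
    show "c (n div 2 ^ d) (n' div 2 ^ d) j = 0" if "j < j0" for j
      using that j0 dig_cong[OF j0(2)] by (simp add: c_def)
    show "c (Suc (n div 2 ^ d)) (Suc (n' div 2 ^ d)) j = 0" if "j < j0" for j
      using that j0(1) dig_cong[OF S] by (simp add: c_def)
    show "c (n div 2 ^ d) (n' div 2 ^ d) j0 = 1"
      using j0(1,3) by (auto simp: c_def bit_add_eq_1_iff)
    show "c (Suc (n div 2 ^ d)) (Suc (n' div 2 ^ d)) j0 = 1"
      using S' j0(1) by (auto simp: c_def bit_add_eq_1_iff)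
  qed (use k j0 in auto)
qed

section \<open>Doubling and rotating affine sequences\<close>

lemma affine_seq_Suc_left:
  assumes "n < 2 ^ d * 2 ^ k"
  shows "affine_seq d N (Suc k) v n = affine_seq d N k v n"
proof -
  have "n div 2 ^ d < 2 ^ k" using assms by (simp add: div_less_iff_less_mult mult.commute)
  then show ?thesis by (simp add: affine_seq_def dig_def)
qed

lemma affine_seq_Suc_right:
  assumes "n < 2 ^ d * 2 ^ k"
  shows "affine_seq d N (Suc k) v (2 ^ d * 2 ^ k + n) =
    affine_seq d N k (\<lambda>p. v p + scol d k (N k) p) n"
proof -
  have B: "n div 2 ^ d < 2 ^ k" using assms by (simp add: div_less_iff_less_mult mult.commute)
  have "dig (2 ^ k + n div 2 ^ d) j = dig (n div 2 ^ d) j" if "j < k" for j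
    using that by (intro dig_cong[of _ k]) auto
  moreover have "dig (2 ^ k + n div 2 ^ d) k = 1" using B by (simp add: dig_def)
  ultimately show ?thesis by (simp add: affine_seq_def add_ac)
qed

lemma add_dig_eq:
  assumes "r = 2 ^ k * c"
  shows "j < k \<Longrightarrow> dig (B + r) j = dig B j" "dig (B + r) k = dig B k + of_nat c"
proof -
  show "dig (B + r) j = dig B j" if "j < k"
    using that by (intro dig_cong[of _ k]) (simp_all add: assms)
  show "dig (B + r) k = dig B k + of_nat c"
    by (simp add: assms dig_def)
qed

lemma dig_power: "dig (2 ^ t) j = (if j = t then 1 else 0)"
  using add_dig_eq(1)[of "2 ^ t" t 1 j 0]
  by (cases j t rule: linorder_cases) (auto simp: dig_def)

lemma affine_seq_first_block: "p < 2 ^ d \<Longrightarrow> affine_seq d N k v p = v p"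
  by (simp add: affine_seq_def dig_def)

lemma affine_seq_block_power:
  assumes "p < 2 ^ d" "t < k"
  shows "affine_seq d N k v (2 ^ d * 2 ^ t + p) = v p + scol d t (N t) p"
proof -
  have "(\<Sum>j<k. dig (2 ^ t) j * scol d j (N j) p) = (\<Sum>j<k. if t = j then scol d j (N j) p else 0)"
    by (intro sum.cong) (auto simp: dig_power)
  then show ?thesis using assms by (simp add: affine_seq_block)
qed

text \<open>A rotation of an affine sequence by a number of blocks with lowest digit \<open>t < k\<close> changes its
  block \<open>2 ^ t\<close> by a vector involving column \<open>t + 1\<close>, which the difference operator tells apart
  from any shifted column \<open>t\<close>.\<close>

lemma affine_rotation_dvd:
  assumes k: "Suc k \<le> 2 ^ d"
    and eq: "\<And>n. affine_seq d N' (Suc k) v' n = affine_seq d N (Suc k) v (n + r * 2 ^ d)"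
  shows "r mod 2 ^ k = 0"
proof (rule ccontr)
  assume "r mod 2 ^ k \<noteq> 0"
  then obtain t where t: "t < k" "r mod 2 ^ t = 0" "dig r t \<noteq> 0"
    using obtain_lowest_dig[of r k 0] by (auto simp: dig_def)
  \<comment> \<open>Coefficients of the difference between blocks \<open>2 ^ t\<close> and 0 of the
    rotated sequence; in the sequence with profile \<open>N'\<close> this difference is column
    \<open>t\<close> alone.\<close>
  define a where "a j = dig (2 ^ t + r) j + dig r j" for j
  have *: "(\<Sum>j<Suc k. a j * scol d j (N j) i) = scol d t (N' t) i" if i: "i < 2 ^ d" for i
  proof -
    have "affine_seq d N' (Suc k) v' (2 ^ d * B + i) =
        v i + (\<Sum>j<Suc k. dig (B + r) j * scol d j (N j) i)" for B
    proof -
      have "2 ^ d * B + i + r * 2 ^ d = 2 ^ d * (B + r) + i" by (simp add: algebra_simps)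
      then show ?thesis using eq[of "2 ^ d * B + i"] affine_seq_block[OF i] by metis
    qed
    note E = this[of "2 ^ t"] this[of 0]
    have "affine_seq d N' (Suc k) v' (2 ^ d * 2 ^ t + i) = v' i + scol d t (N' t) i"
      "affine_seq d N' (Suc k) v' (2 ^ d * 0 + i) = v' i"
      using affine_seq_block_power[OF i, where t = t and k = "Suc k"] affine_seq_first_block[OF i] t by simp_all
    with E have "v' i + scol d t (N' t) i = v i + (\<Sum>j<Suc k. dig (2 ^ t + r) j * scol d j (N j) i)"
      "v' i = v i + (\<Sum>j<Suc k. dig r j * scol d j (N j) i)"
      by simp_all
    moreover have bit_solve: "s = e + f" if "a + s = c + e" "a = c + f" for a c e f s :: bit
      using that by (cases a; cases c; cases e; cases f; cases s) simp_all
    ultimately have "scol d t (N' t) i = (\<Sum>j<Suc k. dig (2 ^ t + r) j * scol d j (N j) i) +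
        (\<Sum>j<Suc k. dig r j * scol d j (N j) i)"
      using bit_solve by blast
    then show ?thesis by (simp only: a_def distrib_right sum.distrib)
  qed
  have eq': "(\<lambda>i. \<Sum>j<Suc k. a j * scol d j (N j) i) = scol d t (N' t)"
  proof
    fix i
    show "(\<Sum>j<Suc k. a j * scol d j (N j) i) = scol d t (N' t) i"
      using *[of "i mod 2 ^ d"] by (simp only: scol_mod mod_less_divisor zero_less_power zero_less_numeral)
  qed
  \<comment> \<open>\<open>Del ^^ Suc t\<close> kills column \<open>t\<close>, so no higher column
    can contribute.\<close>
  have "a (Suc t) = 0"
  proof (rule sum_scol_top_coeff_zero[where T = "Suc t" and K = "Suc k" and d = d and N = N])
    show "(Del ^^ Suc t) (\<lambda>i. \<Sum>j<Suc k. a j * scol d j (N j) i) i = 0" for i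
      unfolding eq' by (rule Del_pow_scol_eq_0) (use t k in auto)
  qed (use t k in auto)
  \<comment> \<open>Digit \<open>t\<close> of \<open>r\<close> is 1, so adding \<open>2 ^ t\<close>
    carries into digit \<open>t + 1\<close> and flips it.\<close>
  moreover have "a (Suc t) = 1"
  proof -
    obtain c where c: "r = 2 ^ t * c" using t(2) by auto
    have "odd c" using t(3) by (simp add: dig_def c of_nat_bit_eq)
    then obtain e where e: "c = Suc (2 * e)" by (metis oddE Suc_eq_plus1)
    have r: "r = 2 ^ Suc t * e + 2 ^ t" "2 ^ t + r = 2 ^ Suc t * Suc e"
      by (simp_all add: c e algebra_simps)
    have "r div 2 ^ Suc t = e" unfolding r(1) by (subst div_mult_self4) auto
    moreover have "(2 ^ t + r) div 2 ^ Suc t = Suc e" unfolding r(2)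
      by (rule nonzero_mult_div_cancel_left) simp
    ultimately show ?thesis unfolding a_def dig_def by (simp add: add.assoc)
  qed
  ultimately show False by simp
qed

section \<open>Nested words\<close>

fun nested_word :: "nat \<Rightarrow> nat \<Rightarrow> word \<Rightarrow> bool" where
  "nested_word 0 m w \<longleftrightarrow> length w = m"
| "nested_word (Suc k) m w \<longleftrightarrow> length w = m * 2 ^ Suc k \<and>
     nested_word k m (take (m * 2 ^ k) w) \<and> nested_word k m (drop (m * 2 ^ k) w) \<and>
     perfect_seq (Suc k) m (\<lambda>i. w ! (i mod length w))"

text \<open>Every smaller block length divides half the length, so an aligned block is the whole
  word or lies in one half.\<close>

lemma blocks_perfect_iff_nested_word:
  assumes m: "0 < m"
  shows "length w = m * 2 ^ k \<and>
     (\<forall>l \<in> {1..k}. \<forall>p. p mod (m * 2 ^ l) = 0 \<and> p + m * 2 ^ l \<le> length w \<longrightarrow>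
        perfect_necklace l m (necklace (take (m * 2 ^ l) (drop p w)))) \<longleftrightarrow> nested_word k m w"
    (is "?Q k w \<longleftrightarrow> _")
proof (induction k arbitrary: w)
  case 0
  then show ?case by simp
next
  case (Suc k)
  define h where "h = m * 2 ^ k"
  have h: "m * 2 ^ Suc k = h + h" by (simp add: h_def)
  have dvd: "m * 2 ^ l dvd h" if "l \<le> k" for l
    using that by (simp add: h_def le_imp_power_dvd)
  have left: "take (m * 2 ^ l) (drop p (take h w)) = take (m * 2 ^ l) (drop p w)"
    if "p + m * 2 ^ l \<le> h" for l p
    using that by (simp add: drop_take min_def)
  have right: "take (m * 2 ^ l) (drop p (drop h w)) = take (m * 2 ^ l) (drop (h + p) w)" for l p
    by (simp add: add.commute)
  have "?Q (Suc k) w \<longleftrightarrow> length w = h + h \<and> ?Q k (take h w) \<and> ?Q k (drop h w) \<and>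
      perfect_necklace (Suc k) m (necklace w)"
  proof
    assume Q: "?Q (Suc k) w"
    then have len: "length w = h + h" using h by simp
    from Q have blk: "perfect_necklace l m (necklace (take (m * 2 ^ l) (drop p w)))"
      if "1 \<le> l" "l \<le> Suc k" "p mod (m * 2 ^ l) = 0" "p + m * 2 ^ l \<le> h + h" for l p
      using that len by auto
    have "?Q k (take h w)"
      using blk len left by (auto simp: h_def)
    moreover have "?Q k (drop h w)"
    proof (intro conjI ballI allI impI)
      fix l p assume l: "l \<in> {1..k}" and p: "p mod (m * 2 ^ l) = 0 \<and> p + m * 2 ^ l \<le> length (drop h w)"
      have "(h + p) mod (m * 2 ^ l) = 0" using dvd[of l] l p by auto
      then show "perfect_necklace l m (necklace (take (m * 2 ^ l) (drop p (drop h w))))"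
        unfolding right using l p len by (intro blk) auto
    qed (use len in \<open>simp add: h_def\<close>)
    moreover have "perfect_necklace (Suc k) m (necklace w)"
      using blk[of "Suc k" 0] len h by simp
    ultimately show "length w = h + h \<and> ?Q k (take h w) \<and> ?Q k (drop h w) \<and>
      perfect_necklace (Suc k) m (necklace w)" using len by blast
  next
    assume Q: "length w = h + h \<and> ?Q k (take h w) \<and> ?Q k (drop h w) \<and>
      perfect_necklace (Suc k) m (necklace w)"
    then have len: "length w = h + h" by blast
    note Qk = Q[THEN conjunct2, THEN conjunct1] Q[THEN conjunct2, THEN conjunct2, THEN conjunct1]
    have Qx: "perfect_necklace l m (necklace (take (m * 2 ^ l) (drop p (take h w))))"
      if "l \<in> {1..k}" "p mod (m * 2 ^ l) = 0" "p + m * 2 ^ l \<le> h" for l p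
      by (rule Qk(1)[THEN conjunct2, rule_format]) (use that len in auto)
    have Qy: "perfect_necklace l m (necklace (take (m * 2 ^ l) (drop p (drop h w))))"
      if "l \<in> {1..k}" "p mod (m * 2 ^ l) = 0" "p + m * 2 ^ l \<le> h" for l p
      by (rule Qk(2)[THEN conjunct2, rule_format]) (use that len in auto)
    have "perfect_necklace l m (necklace (take (m * 2 ^ l) (drop p w)))"
      if l: "1 \<le> l" "l \<le> Suc k" and p: "p mod (m * 2 ^ l) = 0" "p + m * 2 ^ l \<le> h + h" for l p
    proof (cases "l = Suc k")
      case True
      then have "p = 0" using p h by simp
      then show ?thesis using Q True len h by simp
    next
      case False
      then have lk: "l \<le> k" using l by simp
      show ?thesis
      proof (cases "p + m * 2 ^ l \<le> h")
        case True
        then have "perfect_necklace l m (necklace (take (m * 2 ^ l) (drop p (take h w))))"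
          using Qx l lk p by simp
        then show ?thesis using left[OF True] by simp
      next
        case False
        obtain a where a: "p = m * 2 ^ l * a" using p(1) by auto
        obtain b where b: "h = m * 2 ^ l * b" using dvd[OF lk] by auto
        have "m * 2 ^ l * b < m * 2 ^ l * Suc a" using False a b by simp
        then have "b \<le> a" using m by (simp only: mult_less_cancel1) simp
        then have "h \<le> p" by (simp add: a b)
        then obtain p' where p': "p = h + p'" using le_Suc_ex by blast
        then have "p' mod (m * 2 ^ l) = 0" "p' + m * 2 ^ l \<le> h"
          using p dvd[OF lk] by (auto simp: dvd_add_right_iff)
        then have "perfect_necklace l m (necklace (take (m * 2 ^ l) (drop p' (drop h w))))"
          using Qy l lk by (simp del: drop_drop)
        then show ?thesis using right p' by simp
      qed
    qed
    then show "?Q (Suc k) w" using len h by auto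
  qed
  also have "\<dots> \<longleftrightarrow> nested_word (Suc k) m w"
    unfolding Suc.IH unfolding nested_word.simps h h_def[symmetric]
    using perfect_necklace_iff_perfect_seq[of w m "Suc k", unfolded h] m zero_less_Suc[of k] by blast
  finally show ?case .
qed

lemma nested_perfect_necklace_iff:
  "0 < k \<Longrightarrow> 0 < m \<Longrightarrow> nested_perfect_necklace k m w \<longleftrightarrow> nested_word k m w"
  unfolding nested_perfect_necklace_def by (simp flip: blocks_perfect_iff_nested_word)

section \<open>Affine words are nested, and conversely\<close>

definition affine_word :: "nat \<Rightarrow> (nat \<Rightarrow> nat) \<Rightarrow> nat \<Rightarrow> (nat \<Rightarrow> bit) \<Rightarrow> word" where
  "affine_word d N k v = map (affine_seq d N k v) [0..<2 ^ d * 2 ^ k]"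

lemma affine_word_length [simp]: "length (affine_word d N k v) = 2 ^ d * 2 ^ k"
  by (simp add: affine_word_def)

lemma affine_word_nth: "i < 2 ^ d * 2 ^ k \<Longrightarrow> affine_word d N k v ! i = affine_seq d N k v i"
  by (simp add: affine_word_def)

lemma affine_word_cyclic:
  "(\<lambda>i. affine_word d N k v ! (i mod (2 ^ d * 2 ^ k))) = affine_seq d N k v"
  using periodic_mod[of "affine_seq d N k v" "2 ^ d * 2 ^ k", OF affine_seq_periodic]
  by (simp add: affine_word_nth)

text \<open>The top digit \<open>k\<close> is 0 in the first half and 1 in the second, where it adds
  column \<open>k\<close> to every block.\<close>

lemma affine_word_Suc:
  "affine_word d N (Suc k) v =
    affine_word d N k v @ affine_word d N k (\<lambda>p. v p + scol d k (N k) p)"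
  by (rule nth_equalityI)
    (auto simp: affine_word_nth nth_append affine_seq_Suc_left not_less
      affine_seq_Suc_right[symmetric])

lemma nested_affine_word:
  assumes "valid_profile N" "k \<le> 2 ^ d"
  shows "nested_word k (2 ^ d) (affine_word d N k v)"
  using assms(2)
proof (induction k arbitrary: v)
  case (Suc k)
  have "perfect_seq (Suc k) (2 ^ d) (\<lambda>i. affine_word d N (Suc k) v ! (i mod (2 ^ d * 2 ^ Suc k)))"
    unfolding affine_word_cyclic using assms(1) Suc.prems by (rule affine_seq_perfect)
  moreover have "take (2 ^ d * 2 ^ k) (affine_word d N (Suc k) v) = affine_word d N k v"
    "drop (2 ^ d * 2 ^ k) (affine_word d N (Suc k) v) =
      affine_word d N k (\<lambda>p. v p + scol d k (N k) p)"
    by (simp_all add: affine_word_Suc)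
  ultimately show ?case using Suc by simp
qed simp

lemma extend_profile:
  assumes "valid_profile N" "s = N k \<or> s = Suc (N k)"
  shows "valid_profile (\<lambda>j. if j \<le> k then N j else s)"
  unfolding valid_profile_def
proof (intro conjI allI)
  fix j
  show "(if Suc j \<le> k then N (Suc j) else s) = (if j \<le> k then N j else s) \<or>
      (if Suc j \<le> k then N (Suc j) else s) = Suc (if j \<le> k then N j else s)"
    using assms by (cases "j = k") (auto simp: valid_profile_def)
qed (use assms in \<open>simp add: valid_profile_def\<close>)

text \<open>By \<open>affine_rotation_dvd\<close> the rotation is by a multiple of half the blocks.
  An odd multiple flips digit \<open>k\<close> everywhere, which adds column \<open>k\<close>, and
  \<open>scol_add_shift\<close> absorbs it into the shift of column \<open>Suc k\<close>.\<close>

lemma second_half_affine: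
  assumes N: "valid_profile N" and k: "Suc k < 2 ^ d"
    and z: "\<And>n. affine_seq d N' (Suc k) v' n =
      affine_seq d N (Suc k) (\<lambda>p. v p + scol d (Suc k) (N k) p) (n + r * 2 ^ d)"
  obtains s where "s = N k \<or> s = Suc (N k)"
    "\<And>n. affine_seq d N' (Suc k) v' n = affine_seq d N (Suc k) (\<lambda>p. v p + scol d (Suc k) s p) n"
proof -
  have "r mod 2 ^ k = 0" using k z by (intro affine_rotation_dvd) auto
  then obtain c where c: "r = 2 ^ k * c" by auto
  define s where "s = (if odd c then Suc (N k) else N k)"
  have Nk: "N k < 2 ^ d" using valid_profile_le[OF N, of k] k by simp
  have sc: "scol d (Suc k) (N k) p + of_nat c * scol d k (N k) p = scol d (Suc k) s p" for p
    using scol_add_shift[OF k Nk, of p, symmetric] unfolding s_def of_nat_bit_eq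
    by (simp flip: add.assoc)
  show thesis
  proof (rule that)
    show "s = N k \<or> s = Suc (N k)" by (simp add: s_def)
    fix n :: nat
    let ?B = "n div 2 ^ d"
    let ?S = "\<Sum>j<k. dig ?B j * scol d j (N j) n"
    have "affine_seq d N' (Suc k) v' n = v (n mod 2 ^ d) + scol d (Suc k) (N k) n +
        (?S + (dig ?B k + of_nat c) * scol d k (N k) n)"
      unfolding z using add_dig_eq[OF c] by (simp add: affine_seq_def mult.commute[of r] add.commute[of r])
    also have "\<dots> = v (n mod 2 ^ d) + (scol d (Suc k) (N k) n + of_nat c * scol d k (N k) n) +
        (?S + dig ?B k * scol d k (N k) n)"
      by (simp add: distrib_right add_ac)
    also have "\<dots> = affine_seq d N (Suc k) (\<lambda>p. v p + scol d (Suc k) s p) n"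
      unfolding sc by (simp add: affine_seq_def)
    finally show "affine_seq d N' (Suc k) v' n =
      affine_seq d N (Suc k) (\<lambda>p. v p + scol d (Suc k) s p) n" .
  qed
qed

lemma nested_imp_affine_word:
  assumes "nested_word k (2 ^ d) w" "k \<le> 2 ^ d"
  obtains N v where "valid_profile N" "w = affine_word d N k v"
  using assms
proof (induction k arbitrary: w thesis)
  case 0
  have "valid_profile (\<lambda>_. 0)" by (simp add: valid_profile_def)
  moreover have "w = affine_word d (\<lambda>_. 0) 0 ((!) w)"
    using 0 by (intro nth_equalityI) (simp_all add: affine_word_nth affine_seq_def)
  ultimately show ?case using 0 by blast
next
  case (Suc k)
  define L where "L = (2::nat) ^ d * 2 ^ k"
  have k: "k < 2 ^ d" using Suc.prems by simp
  have len: "length w = 2 * L" using Suc.prems(2) by (simp add: L_def)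
  obtain N v where N: "valid_profile N" and X: "take L w = affine_word d N k v"
    using Suc.IH[of "take L w"] Suc.prems k by (auto simp: L_def)
  obtain N' v' where N': "valid_profile N'" and Y: "drop L w = affine_word d N' k v'"
    using Suc.IH[of "drop L w"] Suc.prems k by (auto simp: L_def)
  define x y where "x = affine_seq d N k v" and "y = affine_seq d N' k v'"
  have w_eq: "w = affine_word d N k v @ affine_word d N' k v'"
    using X Y by (metis append_take_drop_id)
  have xper: "x (i + 2 * L) = x i" and yper: "y (i + 2 * L) = y i" "y (i + L) = y i" for i
    using affine_seq_periodic[of d N k v i] affine_seq_periodic[of d N k v "i + L"]
      affine_seq_periodic[of d N' k v' i] affine_seq_periodic[of d N' k v' "i + L"]
    unfolding x_def y_def L_def[symmetric] by (simp_all add: add.assoc mult_2)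
  have cyc: "w ! (n mod length w) = (if n mod (2 * L) < L then x n else y n)" for n
  proof (cases "n mod (2 * L) < L")
    case True
    then have "w ! (n mod (2 * L)) = x (n mod (2 * L))"
      by (simp add: w_eq nth_append L_def affine_word_nth x_def)
    then show ?thesis using True len periodic_mod[of x "2 * L", OF xper] by simp
  next
    case False
    have "n mod (2 * L) < 2 * L" by (simp add: L_def)
    then have "n mod (2 * L) - L < L" using False by linarith
    then have "w ! (n mod (2 * L)) = y (n mod (2 * L) - L)"
      using False affine_word_nth[of "n mod (2 * L) - L" d k N' v', folded L_def]
      by (simp add: w_eq nth_append y_def flip: L_def)
    also have "\<dots> = y (n mod (2 * L))"
      using yper(2)[of "n mod (2 * L) - L"] False by simp
    finally show ?thesis using False len periodic_mod[of y "2 * L", OF yper(1)] by simp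
  qed
  have pc: "perfect_concat k (2 ^ d) x y (\<lambda>n. w ! (n mod length w)) L"
  proof
    show "perfect_seq k (2 ^ d) x" "perfect_seq k (2 ^ d) y"
      unfolding x_def y_def using N N' k by (simp_all add: affine_seq_perfect)
    show "perfect_seq (Suc k) (2 ^ d) (\<lambda>n. w ! (n mod length w))"
      using Suc.prems(2) unfolding nested_word.simps by blast
  qed (use k cyc L_def in auto)
  \<comment> \<open>Each admissible shift \<open>s\<close> of column \<open>k\<close> yields a cycle
    complementary to that of \<open>x\<close>, by \<open>affine_seq_complement\<close>.\<close>
  have rot: "\<exists>r. \<forall>n. y n = affine_seq d N k (\<lambda>p. v p + scol d k s p) (n + r * 2 ^ d)"
    if M: "valid_profile M" "\<And>j. j < k \<Longrightarrow> M j = N j" "M k = s" for M s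
  proof -
    have MN: "affine_seq d M k u n = affine_seq d N k u n" for u n
      using M by (intro affine_seq_cong) auto
    let ?z = "affine_seq d N k (\<lambda>p. v p + scol d k s p)"
    have "perfect_seq k (2 ^ d) ?z" using N k by (simp add: affine_seq_perfect)
    moreover have "x (i + k) \<noteq> ?z (j + k)"
      if "i mod 2 ^ d = j mod 2 ^ d" "\<And>t. t < k \<Longrightarrow> x (i + t) = ?z (j + t)" for i j
    proof
      assume "x (i + k) = ?z (j + k)"
      then have "x (i + t) = ?z (j + t)" if "t \<le> k" for t
        using that \<open>\<And>t. t < k \<Longrightarrow> x (i + t) = ?z (j + t)\<close> by (cases "t = k") auto
      then show False
        using affine_seq_complement[OF M(1) k \<open>i mod 2 ^ d = j mod 2 ^ d\<close>, of v]
        unfolding MN M(3) x_def by blast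
    qed
    ultimately obtain r where "\<And>n. y n = ?z (n + r * 2 ^ d)"
      using perfect_concat.second_half_rotation[OF pc] by blast
    then show ?thesis by blast
  qed
  have fin: thesis if M: "valid_profile M" "\<And>j. j < k \<Longrightarrow> M j = N j"
    and yz: "\<And>n. y n = affine_seq d N k (\<lambda>p. v p + scol d k (M k) p) n" for M
  proof (rule Suc.prems(1))
    have "affine_seq d M k u n = affine_seq d N k u n" for u n
      using M by (intro affine_seq_cong) auto
    moreover have "affine_word d N' k v' = affine_word d N k (\<lambda>p. v p + scol d k (M k) p)"
      using yz unfolding affine_word_def y_def by simp
    ultimately show "w = affine_word d M (Suc k) v"
      unfolding w_eq affine_word_Suc by (simp add: affine_word_def)
  qed (rule M(1))
  show ?case
  proof (cases k)
    case 0
    then obtain r where "\<And>n. y n = affine_seq d N k (\<lambda>p. v p + scol d k (N k) p) (n + r * 2 ^ d)"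
      using rot[of N "N k"] N by auto
    \<comment> \<open>Without digits the sequences have period \<open>2 ^ d\<close>, so rotating by
      blocks changes nothing.\<close>
    then show thesis
      using 0 by (intro fin[of N]) (auto simp: N affine_seq_def)
  next
    case (Suc k')
    \<comment> \<open>The trial column repeats the shift \<open>N k'\<close>; the rotation then
      reveals the true shift \<open>s\<close>.\<close>
    then obtain r where "\<And>n. y n = affine_seq d N k (\<lambda>p. v p + scol d k (N k') p) (n + r * 2 ^ d)"
      using rot[OF extend_profile[OF N, of "N k'" k']] by auto
    then obtain s where s: "s = N k' \<or> s = Suc (N k')"
      "\<And>n. y n = affine_seq d N k (\<lambda>p. v p + scol d k s p) n"
      using second_half_affine[OF N, of k' d N' v' v r] k unfolding y_def Suc by metis
    show thesis
      by (rule fin[OF extend_profile[OF N s(1)]]) (use s(2) Suc in simp_all)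
  qed
qed

text \<open>The first block is \<open>v\<close>, and added to block \<open>2 ^ j\<close> it leaves
  column \<open>j\<close>, whose shift is the position of its first nonzero entry.\<close>

lemma affine_word_eqD:
  assumes N: "valid_profile N" "valid_profile N'" and k: "k \<le> 2 ^ d"
    and eq: "affine_word d N k v = affine_word d N' k v'"
  shows "\<And>p. p < 2 ^ d \<Longrightarrow> v p = v' p" "\<And>j. j < k \<Longrightarrow> N j = N' j"
proof -
  have nth: "affine_seq d N k v i = affine_seq d N' k v' i" if "i < 2 ^ d * 2 ^ k" for i
    using eq that by (metis affine_word_nth)
  have *: "2 ^ d * B + p < 2 ^ d * 2 ^ k" if "B < 2 ^ k" "p < 2 ^ d" for B p :: nat
    using that mult_le_mono2[of "Suc B" "2 ^ k" "2 ^ d"] by simp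
  show v: "v p = v' p" if "p < 2 ^ d" for p
    using nth[of p] *[of 0 p] that affine_seq_first_block[OF that] by simp
  have sc: "scol d j (N j) p = scol d j (N' j) p" if "j < k" "p < 2 ^ d" for j p
    using nth[OF *[of "2 ^ j" p]] that v[of p] by (simp add: affine_seq_block_power)
  show "N j = N' j" if j: "j < k" for j
  proof (rule ccontr)
    assume "N j \<noteq> N' j"
    have le: "N j \<le> j" "N' j \<le> j" using N by (auto intro: valid_profile_le)
    then show False
      using \<open>N j \<noteq> N' j\<close> sc[OF j, of "N j"] sc[OF j, of "N' j"] k j
        scol_one_start[OF le(1), of d] scol_one_start[OF le(2), of d]
        scol_zero_start[OF le(1), of d "N' j"] scol_zero_start[OF le(2), of d "N j"]
      by (cases "N j < N' j") auto
  qed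
qed

section \<open>Affine necklaces\<close>

lemma enum_words_nth:
  "B < 2 ^ m \<Longrightarrow> c < m \<Longrightarrow> enum_words m ! B ! c = dig B (m - 1 - c)"
proof (induction m arbitrary: B c)
  case (Suc m)
  show ?case
  proof (cases "B < 2 ^ m")
    case True
    have eq: "enum_words (Suc m) ! B = 0 # enum_words m ! B"
      using True by (simp add: nth_append length_enum_words)
    show ?thesis
    proof (cases c)
      case 0
      then show ?thesis unfolding eq using True by (simp add: dig_def)
    next
      case (Suc c')
      then show ?thesis unfolding eq using True Suc.IH[of B c'] Suc.prems by simp
    qed
  next
    case False
    then obtain B' where B': "B = 2 ^ m + B'" by (metis le_Suc_ex not_less)
    then have lt: "B' < 2 ^ m" using Suc.prems by simp
    have eq: "enum_words (Suc m) ! B = 1 # enum_words m ! B'"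
      using lt by (simp add: B' nth_append length_enum_words)
    show ?thesis
    proof (cases c)
      case 0
      then show ?thesis unfolding eq using lt by (simp add: dig_def B')
    next
      case (Suc c')
      have "dig B (m - 1 - c') = dig B' (m - 1 - c')"
        using Suc Suc.prems by (intro dig_cong[of _ m]) (auto simp: B')
      then show ?thesis unfolding eq using Suc lt Suc.IH[of B' c'] Suc.prems by simp
    qed
  qed
qed simp

section \<open>Entries of the shifted matrices\<close>

lemma length_shift [simp]: "length (shift w) = length w"
  by (cases w) (simp_all add: shift_def)

lemma length_shift_funpow: "length ((shift ^^ n) w) = length w"
  by (induction n) simp_all

lemma shift_nth:
  assumes "i < length w"
  shows "shift w ! i = w ! ((i + (length w - 1)) mod length w)"
proof (cases i)
  case 0
  then show ?thesis using assms by (auto simp: shift_def last_conv_nth)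
next
  case (Suc i')
  then have "i + (length w - 1) = i' + length w" using assms by simp
  then have "(i + (length w - 1)) mod length w = i'" using assms Suc by (simp only: mod_add_self2) simp
  then show ?thesis using assms Suc by (auto simp: shift_def nth_butlast)
qed

lemma shift_funpow_nth:
  "n \<le> length w \<Longrightarrow> i < length w \<Longrightarrow>
    (shift ^^ n) w ! i = w ! ((i + (length w - n)) mod length w)"
proof (induction n arbitrary: i)
  case (Suc n)
  let ?m = "length w"
  have lt: "(i + (?m - 1)) mod ?m < ?m" using Suc.prems by (intro mod_less_divisor) linarith
  have "(shift ^^ Suc n) w ! i = (shift ^^ n) w ! ((i + (?m - 1)) mod ?m)"
    using shift_nth[of i "(shift ^^ n) w"] Suc.prems by (simp add: length_shift_funpow)
  also have "\<dots> = w ! (((i + (?m - 1)) mod ?m + (?m - n)) mod ?m)"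
    using Suc.IH[OF _ lt] Suc.prems by simp
  also have "((i + (?m - 1)) mod ?m + (?m - n)) mod ?m = (i + (?m - 1) + (?m - n)) mod ?m"
    by (rule mod_add_left_eq)
  also have "i + (?m - 1) + (?m - n) = (i + (?m - Suc n)) + ?m" using Suc.prems by simp
  also have "((i + (?m - Suc n)) + ?m) mod ?m = (i + (?m - Suc n)) mod ?m" by (rule mod_add_self2)
  finally show ?case .
qed simp

text \<open>Beyond \<open>m - 1\<close> truncated subtraction repeats the first entry, so the
  profile continues constantly.\<close>

definition profile :: "nat \<Rightarrow> nat list \<Rightarrow> nat \<Rightarrow> nat" where
  "profile m ns j = ns ! (m - 1 - j)"

lemma valid_profile_profile:
  assumes "valid_shifts m ns"
  shows "valid_profile (profile m ns)"
  unfolding valid_profile_def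
proof (intro conjI allI)
  show "profile m ns 0 = 0" using assms by (simp add: valid_shifts_def profile_def)
  fix j
  show "profile m ns (Suc j) = profile m ns j \<or> profile m ns (Suc j) = Suc (profile m ns j)"
  proof (cases "Suc j < m")
    case True
    have "Suc (m - 1 - Suc j) = m - 1 - j" using True by simp
    moreover have "m - 1 - j < m" using True by simp
    ultimately have "ns ! (m - 1 - j) \<le> ns ! (m - 1 - Suc j)"
      "ns ! (m - 1 - Suc j) \<le> Suc (ns ! (m - 1 - j))"
      using assms unfolding valid_shifts_def by (metis, metis Suc_eq_plus1)
    then show ?thesis unfolding profile_def by linarith
  qed (simp add: profile_def)
qed

lemma shifted_Mmat_dims [simp]:
  "dim_row (shifted_Mmat d ns) = 2 ^ d" "dim_col (shifted_Mmat d ns) = 2 ^ d"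
  by (simp_all add: shifted_Mmat_def)

lemma shifted_Mmat_index:
  assumes ns: "valid_shifts (2 ^ d) ns" and p: "p < 2 ^ d" and c: "c < 2 ^ d"
  shows "shifted_Mmat d ns $$ (p, 2 ^ d - Suc c) = scol d c (profile (2 ^ d) ns c) p"
proof -
  have "profile (2 ^ d) ns c < 2 ^ d"
    using valid_profile_le[OF valid_profile_profile[OF ns], of c] c by simp
  then have "(shift ^^ profile (2 ^ d) ns c) (list_of_vec (col (Mmat d) (2 ^ d - 1 - c))) ! p =
      scol d c (profile (2 ^ d) ns c) p"
    using p c by (simp add: shift_funpow_nth scol_def list_of_vec_index)
  then show ?thesis
    using p c by (simp add: shifted_Mmat_def mat_of_cols_index profile_def vec_of_list_index)
qed

lemma shifted_Mmat_mult_index: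
  assumes ns: "valid_shifts (2 ^ d) ns" and p: "p < 2 ^ d" and x: "dim_vec x = 2 ^ d"
  shows "(shifted_Mmat d ns *\<^sub>v x) $ p =
    (\<Sum>j<2 ^ d. x $ (2 ^ d - Suc j) * scol d j (profile (2 ^ d) ns j) p)"
proof -
  have "(shifted_Mmat d ns *\<^sub>v x) $ p = (\<Sum>j<2 ^ d. shifted_Mmat d ns $$ (p, j) * x $ j)"
    using p x by (simp add: scalar_prod_def lessThan_atLeast0)
  also have "\<dots> = (\<Sum>j<2 ^ d. shifted_Mmat d ns $$ (p, 2 ^ d - Suc j) * x $ (2 ^ d - Suc j))"
    by (rule sum.nat_diff_reindex[symmetric])
  also have "\<dots> = (\<Sum>j<2 ^ d. x $ (2 ^ d - Suc j) * scol d j (profile (2 ^ d) ns j) p)"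
    by (intro sum.cong refl) (simp add: shifted_Mmat_index[OF ns p] mult.commute)
  finally show ?thesis .
qed

definition offset :: "nat \<Rightarrow> nat list \<Rightarrow> word \<Rightarrow> word" where
  "offset d ns z = list_of_vec (shifted_Mmat d ns *\<^sub>v vec_of_list z)"

lemma length_offset [simp]: "length (offset d ns z) = 2 ^ d"
  by (simp add: offset_def)

lemma offset_nth:
  assumes "valid_shifts (2 ^ d) ns" "p < 2 ^ d" "length z = 2 ^ d"
  shows "offset d ns z ! p = (\<Sum>j<2 ^ d. z ! (2 ^ d - Suc j) * scol d j (profile (2 ^ d) ns j) p)"
  using assms by (simp add: offset_def list_of_vec_index shifted_Mmat_mult_index vec_of_list_index
      del: index_mult_mat_vec)

text \<open>Linear independence of the columns makes the map injective on a finite set. Hence the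
  first block may be prescribed instead of \<open>z\<close>.\<close>

lemma offset_surj:
  assumes ns: "valid_shifts (2 ^ d) ns"
  shows "offset d ns ` {z. length z = 2 ^ d} = {v. length v = 2 ^ d}"
proof (rule endo_inj_surj)
  show "finite {z :: word. length z = 2 ^ d}"
    using set_enum_words[of "2 ^ d"] by (metis List.finite_set)
  show "inj_on (offset d ns) {z. length z = 2 ^ d}"
  proof (rule inj_onI)
    fix z z' assume z: "z \<in> {z. length z = 2 ^ d}" "z' \<in> {z. length z = 2 ^ d}"
      and eq: "offset d ns z = offset d ns z'"
    define a where "a j = z ! (2 ^ d - Suc j) + z' ! (2 ^ d - Suc j)" for j
    have zero: "(\<Sum>j<2 ^ d. a j * scol d j (profile (2 ^ d) ns j) i) = 0" for i
    proof -
      have "(\<Sum>j<2 ^ d. a j * scol d j (profile (2 ^ d) ns j) (i mod 2 ^ d)) =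
          offset d ns z ! (i mod 2 ^ d) + offset d ns z' ! (i mod 2 ^ d)"
        using z by (simp add: a_def offset_nth[OF ns] distrib_right sum.distrib)
      then show ?thesis using eq by simp
    qed
    have a0: "a j = 0" if "j < 2 ^ d" for j
      by (rule sum_scol_top_coeff_zero[where T = 0 and K = "2 ^ d" and d = d
            and N = "profile (2 ^ d) ns"]) (use zero that in auto)
    show "z = z'"
    proof (rule nth_equalityI)
      fix i assume "i < length z"
      then have "i < 2 ^ d" using z by simp
      then show "z ! i = z' ! i" using a0[of "2 ^ d - Suc i"] by (simp add: a_def)
    qed (use z in simp)
  qed
qed auto

lemma concat_uniform:
  assumes "\<And>i. i < n \<Longrightarrow> length (f i) = m"
  shows "concat (map f [0..<n]) = map (\<lambda>i. f (i div m) ! (i mod m)) [0..<m * n]"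
  using assms
proof (induction n)
  case (Suc n)
  have "[0..<m * Suc n] = [0..<m * n] @ [m * n..<m * n + m]"
    using upt_add_eq_append[of 0 "m * n" m] by (simp add: add.commute)
  moreover have "map (\<lambda>i. f (i div m) ! (i mod m)) [m * n..<m * n + m] = f n"
    using Suc.prems[of n] by (intro nth_equalityI) auto
  ultimately show ?case using Suc by simp
qed simp

text \<open>In lexicographic order word \<open>B\<close> spells \<open>B\<close> in binary, most
  significant digit first, so digit \<open>j\<close> meets column \<open>j\<close> from the right;
  by linearity \<open>z\<close> contributes the same offset to each block.\<close>

lemma affine_necklace_word:
  assumes ns: "valid_shifts (2 ^ d) ns" and z: "length z = 2 ^ d"
  shows "concat (map (\<lambda>u. list_of_vec (shifted_Mmat d ns *\<^sub>v (vec_of_list u + vec_of_list z)))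
      (take (2 ^ 2 ^ d) (lex_words (2 ^ d)))) =
    affine_word d (profile (2 ^ d) ns) (2 ^ d) ((!) (offset d ns z))"
proof -
  let ?m = "2 ^ d :: nat"
  let ?g = "\<lambda>u. list_of_vec (shifted_Mmat d ns *\<^sub>v (vec_of_list u + vec_of_list z))"
  define W where "W = enum_words ?m"
  have W: "length W = 2 ^ ?m" by (simp add: W_def length_enum_words)
  have "take (2 ^ ?m) (lex_words ?m) = map ((!) W) [0..<2 ^ ?m]"
    using W by (simp add: lex_words_eq_enum_words map_nth flip: W_def W)
  then have "concat (map ?g (take (2 ^ ?m) (lex_words ?m))) =
      concat (map (\<lambda>B. ?g (W ! B)) [0..<2 ^ ?m])" by (simp add: comp_def)
  also have "\<dots> = map (\<lambda>i. ?g (W ! (i div ?m)) ! (i mod ?m)) [0..<?m * 2 ^ ?m]"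
    by (rule concat_uniform) simp
  also have "\<dots> = affine_word d (profile ?m ns) ?m ((!) (offset d ns z))"
    unfolding affine_word_def
  proof (rule map_cong[OF refl])
    fix i assume "i \<in> set [0..<?m * 2 ^ ?m]"
    then have B: "i div ?m < 2 ^ ?m" by (simp add: div_less_iff_less_mult mult.commute)
    have "W ! (i div ?m) \<in> set W" using B W by simp
    then have len: "length (W ! (i div ?m)) = ?m" by (simp add: W_def set_enum_words)
    have "?g (W ! (i div ?m)) ! (i mod ?m) = (\<Sum>j<?m. (W ! (i div ?m) ! (?m - Suc j) +
        z ! (?m - Suc j)) * scol d j (profile ?m ns j) (i mod ?m))"
      using z len by (simp add: list_of_vec_index shifted_Mmat_mult_index[OF ns] vec_of_list_index
          del: index_mult_mat_vec)
    also have "\<dots> = (\<Sum>j<?m. (dig (i div ?m) j + z ! (?m - Suc j)) *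
        scol d j (profile ?m ns j) (i mod ?m))"
      using B by (intro sum.cong refl) (simp add: W_def enum_words_nth)
    also have "\<dots> = affine_seq d (profile ?m ns) ?m ((!) (offset d ns z)) i"
      using z by (simp add: affine_seq_def offset_nth[OF ns] distrib_right sum.distrib add.commute)
    finally show "?g (W ! (i div ?m)) ! (i mod ?m) =
      affine_seq d (profile ?m ns) ?m ((!) (offset d ns z)) i" .
  qed
  finally show ?thesis .
qed

section \<open>The classification\<close>

definition affine_params :: "nat \<Rightarrow> (nat list \<times> word) set" where
  "affine_params m = {ns. valid_shifts m ns} \<times> {v. length v = m}"

text \<open>The parameter \<open>v\<close> is the first block instead of \<open>z\<close>, so that
  it can be read off the word.\<close>

definition param_word :: "nat \<Rightarrow> nat list \<times> word \<Rightarrow> word" where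
  "param_word d = (\<lambda>(ns, v). affine_word d (profile (2 ^ d) ns) (2 ^ d) ((!) v))"

lemma affine_necklaces_eq:
  "{w. affine_necklace (2 ^ d) (2 ^ d) w} = param_word d ` affine_params (2 ^ d)"
proof (intro equalityI subsetI)
  fix w assume "w \<in> {w. affine_necklace (2 ^ d) (2 ^ d) w}"
  then obtain d' ns z where d': "(2::nat) ^ d = 2 ^ d'"
    and ns: "valid_shifts (2 ^ d) ns" "length z = 2 ^ d"
    and w: "w = concat (map (\<lambda>u. list_of_vec (shifted_Mmat d' ns *\<^sub>v (vec_of_list u + vec_of_list z)))
              (take (2 ^ 2 ^ d) (lex_words (2 ^ d))))"
    by (auto simp: affine_necklace_def)
  from d' have "d' = d" by simp
  then have "w = param_word d (ns, offset d ns z)"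
    using affine_necklace_word[OF ns] w by (simp add: param_word_def)
  moreover have "(ns, offset d ns z) \<in> affine_params (2 ^ d)" using ns by (simp add: affine_params_def)
  ultimately show "w \<in> param_word d ` affine_params (2 ^ d)" by blast
next
  fix w assume "w \<in> param_word d ` affine_params (2 ^ d)"
  then obtain ns v where ns: "valid_shifts (2 ^ d) ns" and v: "length v = 2 ^ d"
    and w: "w = param_word d (ns, v)" by (auto simp: affine_params_def)
  obtain z where z: "length z = 2 ^ d" "v = offset d ns z"
    using offset_surj[OF ns] v by (metis (mono_tags, lifting) imageE mem_Collect_eq)
  have "w = concat (map (\<lambda>u. list_of_vec (shifted_Mmat d ns *\<^sub>v (vec_of_list u + vec_of_list z)))
              (take (2 ^ 2 ^ d) (lex_words (2 ^ d))))"
    using affine_necklace_word[OF ns z(1)] w z by (simp add: param_word_def)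
  then show "w \<in> {w. affine_necklace (2 ^ d) (2 ^ d) w}"
    unfolding affine_necklace_def using ns z(1) by auto
qed

lemma nested_perfect_necklaces_eq:
  "{w. nested_perfect_necklace (2 ^ d) (2 ^ d) w} = param_word d ` affine_params (2 ^ d)"
proof (intro equalityI subsetI)
  fix w assume "w \<in> {w. nested_perfect_necklace (2 ^ d) (2 ^ d) w}"
  then have "nested_word (2 ^ d) (2 ^ d) w" by (simp add: nested_perfect_necklace_iff)
  then obtain N v where N: "valid_profile N" and w: "w = affine_word d N (2 ^ d) v"
    using nested_imp_affine_word by blast
  define ns where "ns = map (\<lambda>c. N (2 ^ d - Suc c)) [0..<2 ^ d]"
  have "valid_shifts (2 ^ d) ns"
    unfolding valid_shifts_def
  proof (intro conjI allI impI)
    show "ns ! (2 ^ d - 1) = 0" using N by (simp add: ns_def valid_profile_def)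
    fix i assume i: "Suc i < 2 ^ d"
    then have "2 ^ d - Suc i = Suc (2 ^ d - Suc (Suc i))" by simp
    then have "N (2 ^ d - Suc i) = N (2 ^ d - Suc (Suc i)) \<or>
        N (2 ^ d - Suc i) = Suc (N (2 ^ d - Suc (Suc i)))"
      using N by (metis valid_profile_def)
    then show "ns ! Suc i \<le> ns ! i" "ns ! i \<le> ns ! Suc i + 1" using i by (auto simp: ns_def)
  qed (simp add: ns_def)
  then have "(ns, map v [0..<2 ^ d]) \<in> affine_params (2 ^ d)" by (simp add: affine_params_def)
  moreover have "w = param_word d (ns, map v [0..<2 ^ d])"
  proof -
    have "affine_seq d N (2 ^ d) v n =
        affine_seq d (profile (2 ^ d) ns) (2 ^ d) ((!) (map v [0..<2 ^ d])) n" for n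
      by (rule affine_seq_cong) (auto simp: profile_def ns_def)
    then show ?thesis by (simp add: param_word_def w affine_word_def)
  qed
  ultimately show "w \<in> param_word d ` affine_params (2 ^ d)" by blast
next
  fix w assume "w \<in> param_word d ` affine_params (2 ^ d)"
  then show "w \<in> {w. nested_perfect_necklace (2 ^ d) (2 ^ d) w}"
    by (auto simp: affine_params_def param_word_def nested_perfect_necklace_iff
        intro!: nested_affine_word valid_profile_profile)
qed

lemma param_word_inj: "inj_on (param_word d) (affine_params (2 ^ d))"
proof (rule inj_onI, clarify)
  fix ns v ns' v'
  assume params: "(ns, v) \<in> affine_params (2 ^ d)" "(ns', v') \<in> affine_params (2 ^ d)"
    and eq: "param_word d (ns, v) = param_word d (ns', v')"
  have ns: "valid_shifts (2 ^ d) ns" "valid_shifts (2 ^ d) ns'"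
    and v: "length v = 2 ^ d" "length v' = 2 ^ d"
    using params by (simp_all add: affine_params_def)
  note D = affine_word_eqD[OF valid_profile_profile[OF ns(1)] valid_profile_profile[OF ns(2)] order_refl
      eq[unfolded param_word_def prod.case]]
  have "ns = ns'"
  proof (rule nth_equalityI)
    fix i assume "i < length ns"
    then have "i < 2 ^ d" using ns by (simp add: valid_shifts_def)
    then show "ns ! i = ns' ! i" using D(2)[of "2 ^ d - Suc i"] by (simp add: profile_def)
  qed (use ns in \<open>simp add: valid_shifts_def\<close>)
  moreover have "v = v'" using v D(1) by (intro nth_equalityI) auto
  ultimately show "ns = ns' \<and> v = v'" by blast
qed

section \<open>Counting the shift sequences\<close>

lemma valid_shifts_Cons:
  "valid_shifts (Suc (Suc n)) (a # ns) \<longleftrightarrow>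
    valid_shifts (Suc n) ns \<and> (a = hd ns \<or> a = Suc (hd ns))"
proof (cases "length ns = Suc n")
  case True
  then have "hd ns = ns ! 0" by (intro hd_conv_nth) auto
  then show ?thesis
    unfolding valid_shifts_def using True by (auto simp: All_less_Suc2)
qed (auto simp: valid_shifts_def)

text \<open>The last shift is 0, and each earlier one has two choices given its successor in the
  list.\<close>

lemma card_valid_shifts: "card {ns. valid_shifts (Suc n) ns} = 2 ^ n"
proof (induction n)
  case 0
  have "{ns. valid_shifts (Suc 0) ns} = {[0]}"
    by (auto simp: valid_shifts_def length_Suc_conv)
  then show ?case by simp
next
  case (Suc n)
  define f where "f = (\<lambda>(b, ns :: nat list). (hd ns + b) # ns)"
  have "ns \<in> f ` ({0, 1} \<times> {ns. valid_shifts (Suc n) ns})" if "valid_shifts (Suc (Suc n)) ns" for ns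
  proof -
    have "length ns = Suc (Suc n)" using that by (simp add: valid_shifts_def)
    then obtain a ns' where ns: "ns = a # ns'" by (auto simp: length_Suc_conv)
    then have "valid_shifts (Suc n) ns'" "a = hd ns' \<or> a = Suc (hd ns')"
      using that by (simp_all add: valid_shifts_Cons)
    then show ?thesis unfolding ns f_def by force
  qed
  moreover have "valid_shifts (Suc (Suc n)) ns" if "ns \<in> f ` ({0, 1} \<times> {ns. valid_shifts (Suc n) ns})" for ns
    using that by (auto simp: f_def valid_shifts_Cons)
  ultimately have "{ns. valid_shifts (Suc (Suc n)) ns} = f ` ({0, 1} \<times> {ns. valid_shifts (Suc n) ns})"
    by blast
  moreover have "inj_on f ({0, 1} \<times> {ns. valid_shifts (Suc n) ns})"
    by (auto simp: inj_on_def f_def)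
  ultimately show ?case using Suc by (simp add: card_image card_cartesian_product)
qed

theorem theorem2:
  fixes d m :: nat
  assumes "m = 2 ^ d"
  shows "card {w. nested_perfect_necklace m m w} = 2 ^ (2 * m - 1) \<and>
    {w. nested_perfect_necklace m m w} = {w. affine_necklace m m w}"
proof -
  obtain n where n: "m = Suc n" using assms by (metis not0_implies_Suc power_not_zero zero_neq_numeral)
  have "card {w. nested_perfect_necklace m m w} = card (affine_params m)"
    unfolding assms nested_perfect_necklaces_eq by (rule card_image[OF param_word_inj])
  also have "\<dots> = 2 ^ n * 2 ^ m"
    using card_valid_shifts[of n] by (simp add: affine_params_def card_cartesian_product card_words n)
  also have "\<dots> = 2 ^ (2 * m - 1)" by (simp add: n flip: power_add)
  finally show ?thesis
    unfolding assms nested_perfect_necklaces_eq affine_necklaces_eq by simp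
qed

end
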